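(* Let $G$ be a group with subgroups $Z\le K\le N$ such that $N\unlhd G$, $K\unlhd G$, $N$ is abelian, $G/N$ is abelian, $Z\le Z(G)$, and $N/K\le Z(G/K)$. Let $\mu:G/K\times G/K\to Z$ be a mapping with $\mu(xK,K)=1=\mu(K,xK)$ for all $x\in G$; write $\mu(x,y)$ for $\mu(xK,yK)$, and put $\delta(x,y)=\mu(x,y)\mu(y,x)^{-1}$. Let $Q=(G,* )$ be the loop given by $x*y=xy\,\mu(x,y)$. Assume that (1) $\mu(xy,z)=\mu(x,z)\mu(y,z)$ and $\mu(x,yz)=\mu(x,y)\mu(x,z)$ for all $x,y,z\in G$ with $\{x,y,z\}\cap N\ne\emptyset$; (2) $z^{yx}\,\delta([z,y],x)=z^{xy}\,\delta([z,x],y)$ for all $x,y,z\in G$; (3) $G$ is of nilpotency class two and $Q$ is of nilpotency class three. Then there exist a subgroup $A\le Z$ of exponent two and a nontrivial symmetric triadditive mapping $f:(G/N)^3\to A$ such that $$\delta([x,y],z)=f(xN,yN,zN)\quad\text{for all }x,y,z\in G.$$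
   Context: In the group $G$: $y^x=x^{-1}yx$ and $[y,x]=y^{-1}y^x$. For groups $A_0,B_0$, a map $f:A_0^3\to B_0$ is symmetric triadditive if $f(a_1,a_2,a_3)=f(a_{\sigma(1)},a_{\sigma(2)},a_{\sigma(3)})$ for every permutation $\sigma$ of $\{1,2,3\}$ and all $a_i\in A_0$, and $f(ab,c,d)=f(a,c,d)f(b,c,d)$ for all $a,b,c,d\in A_0$. Nontrivial means not identically $1$. For a loop $Q$ (set with binary operation, two-sided neutral element, unique solvability of $ax=b$, $ya=b$): the associator is defined by $(x*y)*z=(x*(y*z))*[x,y,z]$; the nucleus $N(Q)$ is the set of $x$ with $[x,y,z]=[y,x,z]=[y,z,x]=1$ for all $y,z$; the center $Z(Q)$ is the set of $x\in N(Q)$ commuting with all elements of $Q$. Put $Q_0=Q$, $Q_{i+1}=Q_i/Z(Q_i)$; $Q$ has nilpotency class $m$ if $m\ge 0$ is least with $Q_m$ trivial. *)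

theory Defs
  imports "HOL-Algebra.Algebra"
begin

section \<open>Groups\<close>

definition conjg :: "('a, 'b) monoid_scheme \<Rightarrow> 'a \<Rightarrow> 'a \<Rightarrow> 'a" where
  "conjg G y x = inv\<^bsub>G\<^esub> x \<otimes>\<^bsub>G\<^esub> y \<otimes>\<^bsub>G\<^esub> x"

definition commut :: "('a, 'b) monoid_scheme \<Rightarrow> 'a \<Rightarrow> 'a \<Rightarrow> 'a" where
  "commut G y x = inv\<^bsub>G\<^esub> y \<otimes>\<^bsub>G\<^esub> conjg G y x"

definition group_center :: "('a, 'b) monoid_scheme \<Rightarrow> 'a set" where
  "group_center G = {z \<in> carrier G. \<forall>x \<in> carrier G. z \<otimes>\<^bsub>G\<^esub> x = x \<otimes>\<^bsub>G\<^esub> z}"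

definition has_exponent :: "('a, 'b) monoid_scheme \<Rightarrow> nat \<Rightarrow> bool" where
  "has_exponent G n \<longleftrightarrow>
     0 < n \<and> (\<forall>a \<in> carrier G. a [^]\<^bsub>G\<^esub> n = \<one>\<^bsub>G\<^esub>) \<and>
     (\<forall>k. 0 < k \<and> k < n \<longrightarrow> (\<exists>a \<in> carrier G. a [^]\<^bsub>G\<^esub> k \<noteq> \<one>\<^bsub>G\<^esub>))"

definition symmetric_triadditive ::
  "('a, 'c) monoid_scheme \<Rightarrow> ('b, 'd) monoid_scheme \<Rightarrow> ('a \<Rightarrow> 'a \<Rightarrow> 'a \<Rightarrow> 'b) \<Rightarrow> bool" where
  "symmetric_triadditive A B f \<longleftrightarrow>
     f \<in> carrier A \<rightarrow> carrier A \<rightarrow> carrier A \<rightarrow> carrier B \<and>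
     (\<forall>\<sigma> a. \<sigma> permutes {1, 2, 3::nat} \<and> a \<in> {1, 2, 3} \<rightarrow> carrier A \<longrightarrow>
        f (a 1) (a 2) (a 3) = f (a (\<sigma> 1)) (a (\<sigma> 2)) (a (\<sigma> 3))) \<and>
     (\<forall>a \<in> carrier A. \<forall>b \<in> carrier A. \<forall>c \<in> carrier A. \<forall>d \<in> carrier A.
        f (a \<otimes>\<^bsub>A\<^esub> b) c d = f a c d \<otimes>\<^bsub>B\<^esub> f b c d)"

definition nontrivial_map3 ::
  "('a, 'c) monoid_scheme \<Rightarrow> ('b, 'd) monoid_scheme \<Rightarrow> ('a \<Rightarrow> 'a \<Rightarrow> 'a \<Rightarrow> 'b) \<Rightarrow> bool" where
  "nontrivial_map3 A B f \<longleftrightarrow>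
     (\<exists>a \<in> carrier A. \<exists>b \<in> carrier A. \<exists>c \<in> carrier A. f a b c \<noteq> \<one>\<^bsub>B\<^esub>)"


section \<open>Loops and their nilpotency class\<close>

text \<open>Loops are carried by the monoid record type of the algebra library; no associativity
  is built into that type.\<close>

definition is_loop :: "('a, 'b) monoid_scheme \<Rightarrow> bool" where
  "is_loop Q \<longleftrightarrow>
     (\<forall>x \<in> carrier Q. \<forall>y \<in> carrier Q. x \<otimes>\<^bsub>Q\<^esub> y \<in> carrier Q) \<and>
     \<one>\<^bsub>Q\<^esub> \<in> carrier Q \<and>
     (\<forall>x \<in> carrier Q. \<one>\<^bsub>Q\<^esub> \<otimes>\<^bsub>Q\<^esub> x = x \<and> x \<otimes>\<^bsub>Q\<^esub> \<one>\<^bsub>Q\<^esub> = x) \<and>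
     (\<forall>a \<in> carrier Q. \<forall>b \<in> carrier Q.
        (\<exists>!x. x \<in> carrier Q \<and> a \<otimes>\<^bsub>Q\<^esub> x = b) \<and> (\<exists>!y. y \<in> carrier Q \<and> y \<otimes>\<^bsub>Q\<^esub> a = b))"

definition loop_assoc :: "('a, 'b) monoid_scheme \<Rightarrow> 'a \<Rightarrow> 'a \<Rightarrow> 'a \<Rightarrow> 'a" where
  "loop_assoc Q x y z = (THE u. u \<in> carrier Q \<and>
     (x \<otimes>\<^bsub>Q\<^esub> y) \<otimes>\<^bsub>Q\<^esub> z = (x \<otimes>\<^bsub>Q\<^esub> (y \<otimes>\<^bsub>Q\<^esub> z)) \<otimes>\<^bsub>Q\<^esub> u)"

definition loop_nucleus :: "('a, 'b) monoid_scheme \<Rightarrow> 'a set" where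
  "loop_nucleus Q = {x \<in> carrier Q. \<forall>y \<in> carrier Q. \<forall>z \<in> carrier Q.
     loop_assoc Q x y z = \<one>\<^bsub>Q\<^esub> \<and> loop_assoc Q y x z = \<one>\<^bsub>Q\<^esub> \<and> loop_assoc Q y z x = \<one>\<^bsub>Q\<^esub>}"

definition loop_center :: "('a, 'b) monoid_scheme \<Rightarrow> 'a set" where
  "loop_center Q = {x \<in> loop_nucleus Q. \<forall>y \<in> carrier Q. x \<otimes>\<^bsub>Q\<^esub> y = y \<otimes>\<^bsub>Q\<^esub> x}"

text \<open>The quotient of a loop by its center is \<open>Q Mod loop_center Q\<close>: the definition of \<open>Mod\<close>
  (cosets, multiplied as sets) does not presuppose associativity.

  Iterating this quotient changes the type at each step. To stay in one type, a loop whose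
  elements are pairwise disjoint sets is quotiented and the result is then transported along
  \<open>\<Union>\<close>, which identifies a coset (a set of blocks) with the union of its blocks. Lemma
  \<open>central_series_iso\<close> below shows that this transport is an isomorphism.\<close>

definition relabel :: "('a \<Rightarrow> 'c) \<Rightarrow> ('a, 'b) monoid_scheme \<Rightarrow> 'c monoid" where
  "relabel f Q = \<lparr>carrier = f ` carrier Q,
     monoid.mult = (\<lambda>a b. f (inv_into (carrier Q) f a \<otimes>\<^bsub>Q\<^esub> inv_into (carrier Q) f b)),
     one = f \<one>\<^bsub>Q\<^esub>\<rparr>"

primrec central_series :: "('a, 'b) monoid_scheme \<Rightarrow> nat \<Rightarrow> 'a set monoid" where
  "central_series Q 0 = relabel (\<lambda>x. {x}) Q"
| "central_series Q (Suc i) =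
     relabel \<Union> (central_series Q i Mod loop_center (central_series Q i))"

definition trivial_loop :: "('a, 'b) monoid_scheme \<Rightarrow> bool" where
  "trivial_loop Q \<longleftrightarrow> carrier Q = {\<one>\<^bsub>Q\<^esub>}"

definition has_nilpotency_class :: "('a, 'b) monoid_scheme \<Rightarrow> nat \<Rightarrow> bool" where
  "has_nilpotency_class Q m \<longleftrightarrow>
     trivial_loop (central_series Q m) \<and> (\<forall>k < m. \<not> trivial_loop (central_series Q k))"


section \<open>The loop built from a group and a map on a factor group\<close>

definition mu_lift :: "('a, 'b) monoid_scheme \<Rightarrow> 'a set \<Rightarrow> ('a set \<Rightarrow> 'a set \<Rightarrow> 'a) \<Rightarrow> 'a \<Rightarrow> 'a \<Rightarrow> 'a"
  where "mu_lift G K \<mu> x y = \<mu> (K #>\<^bsub>G\<^esub> x) (K #>\<^bsub>G\<^esub> y)"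

definition mu_delta :: "('a, 'b) monoid_scheme \<Rightarrow> 'a set \<Rightarrow> ('a set \<Rightarrow> 'a set \<Rightarrow> 'a) \<Rightarrow> 'a \<Rightarrow> 'a \<Rightarrow> 'a"
  where "mu_delta G K \<mu> x y = mu_lift G K \<mu> x y \<otimes>\<^bsub>G\<^esub> inv\<^bsub>G\<^esub> (mu_lift G K \<mu> y x)"

definition mu_loop :: "('a, 'b) monoid_scheme \<Rightarrow> 'a set \<Rightarrow> ('a set \<Rightarrow> 'a set \<Rightarrow> 'a) \<Rightarrow> 'a monoid"
  where "mu_loop G K \<mu> =
    \<lparr>carrier = carrier G, monoid.mult = (\<lambda>x y. x \<otimes>\<^bsub>G\<^esub> y \<otimes>\<^bsub>G\<^esub> mu_lift G K \<mu> x y), one = \<one>\<^bsub>G\<^esub>\<rparr>"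


section \<open>Well-definedness\<close>

lemma is_loopD:
  assumes "is_loop Q"
  shows "\<And>x y. x \<in> carrier Q \<Longrightarrow> y \<in> carrier Q \<Longrightarrow> x \<otimes>\<^bsub>Q\<^esub> y \<in> carrier Q"
    and "\<one>\<^bsub>Q\<^esub> \<in> carrier Q"
    and "\<And>x. x \<in> carrier Q \<Longrightarrow> \<one>\<^bsub>Q\<^esub> \<otimes>\<^bsub>Q\<^esub> x = x"
    and "\<And>x. x \<in> carrier Q \<Longrightarrow> x \<otimes>\<^bsub>Q\<^esub> \<one>\<^bsub>Q\<^esub> = x"
    and "\<And>a b. a \<in> carrier Q \<Longrightarrow> b \<in> carrier Q \<Longrightarrow> \<exists>!x. x \<in> carrier Q \<and> a \<otimes>\<^bsub>Q\<^esub> x = b"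
    and "\<And>a b. a \<in> carrier Q \<Longrightarrow> b \<in> carrier Q \<Longrightarrow> \<exists>!y. y \<in> carrier Q \<and> y \<otimes>\<^bsub>Q\<^esub> a = b"
  using assms unfolding is_loop_def by auto

lemma is_loop_lcancel:
  assumes "is_loop Q" "a \<in> carrier Q" "x \<in> carrier Q" "y \<in> carrier Q" "a \<otimes>\<^bsub>Q\<^esub> x = a \<otimes>\<^bsub>Q\<^esub> y"
  shows "x = y"
  using is_loopD(5)[OF assms(1,2), of "a \<otimes>\<^bsub>Q\<^esub> x"] is_loopD(1)[OF assms(1)] assms by metis

lemma is_loop_rcancel:
  assumes "is_loop Q" "a \<in> carrier Q" "x \<in> carrier Q" "y \<in> carrier Q" "x \<otimes>\<^bsub>Q\<^esub> a = y \<otimes>\<^bsub>Q\<^esub> a"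
  shows "x = y"
  using is_loopD(6)[OF assms(1,2), of "x \<otimes>\<^bsub>Q\<^esub> a"] is_loopD(1)[OF assms(1)] assms by metis

lemma is_loop_group:
  assumes "group G"
  shows "is_loop G"
proof -
  interpret group G by fact
  have "\<exists>!x. x \<in> carrier G \<and> a \<otimes>\<^bsub>G\<^esub> x = b" if "a \<in> carrier G" "b \<in> carrier G" for a b
    using that by (intro ex1I[of _ "inv\<^bsub>G\<^esub> a \<otimes>\<^bsub>G\<^esub> b"]) (auto simp: m_assoc[symmetric] inv_solve_left)
  moreover have "\<exists>!y. y \<in> carrier G \<and> y \<otimes>\<^bsub>G\<^esub> a = b" if "a \<in> carrier G" "b \<in> carrier G" for a b
    using that by (intro ex1I[of _ "b \<otimes>\<^bsub>G\<^esub> inv\<^bsub>G\<^esub> a"]) (auto simp: m_assoc inv_solve_right)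
  ultimately show ?thesis unfolding is_loop_def by auto
qed

lemma is_loop_mu_loop:
  assumes G: "group G" and Z: "subgroup Z G" and K: "K \<lhd> G" and ZK: "Z \<subseteq> K"
    and Zc: "Z \<subseteq> group_center G"
    and \<mu>: "\<mu> \<in> carrier (G Mod K) \<rightarrow> carrier (G Mod K) \<rightarrow> Z"
    and \<mu>1: "\<And>x. x \<in> carrier G \<Longrightarrow> \<mu> (K #>\<^bsub>G\<^esub> x) K = \<one>\<^bsub>G\<^esub> \<and> \<mu> K (K #>\<^bsub>G\<^esub> x) = \<one>\<^bsub>G\<^esub>"
  shows "is_loop (mu_loop G K \<mu>)"
proof -
  interpret group G by fact
  interpret K: normal K G by fact
  let ?m = "mu_lift G K \<mu>"
  have mZ: "?m x y \<in> Z" if "x \<in> carrier G" "y \<in> carrier G" for x y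
    using \<mu> that unfolding mu_lift_def FactGroup_def RCOSETS_def by (auto simp: Pi_iff)
  have ZG: "z \<in> carrier G" if "z \<in> Z" for z using Z that subgroup.subset by blast
  have com: "z \<otimes>\<^bsub>G\<^esub> x = x \<otimes>\<^bsub>G\<^esub> z" if "z \<in> Z" "x \<in> carrier G" for x z
    using Zc that unfolding group_center_def by auto
  have cl: "K #>\<^bsub>G\<^esub> (x \<otimes>\<^bsub>G\<^esub> z) = K #>\<^bsub>G\<^esub> x" if "x \<in> carrier G" "z \<in> Z" for x z
  proof -
    have "K #>\<^bsub>G\<^esub> (x \<otimes>\<^bsub>G\<^esub> z) = K #>\<^bsub>G\<^esub> (z \<otimes>\<^bsub>G\<^esub> x)" using com that by simp
    also have "\<dots> = (K #>\<^bsub>G\<^esub> z) #>\<^bsub>G\<^esub> x"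
      using that ZG K.subset by (simp add: coset_mult_assoc)
    also have "K #>\<^bsub>G\<^esub> z = K" using that ZK K.subgroup_axioms ZG
      by (intro coset_join2) auto
    finally show ?thesis .
  qed
  have mr: "?m x (y \<otimes>\<^bsub>G\<^esub> z) = ?m x y" and ml: "?m (x \<otimes>\<^bsub>G\<^esub> z) y = ?m x y"
    if "x \<in> carrier G" "y \<in> carrier G" "z \<in> Z" for x y z
    using that cl unfolding mu_lift_def by auto
  have iZ: "inv\<^bsub>G\<^esub> z \<in> Z" if "z \<in> Z" for z using Z that by (simp add: subgroup.m_inv_closed)
  have K1: "K #>\<^bsub>G\<^esub> \<one>\<^bsub>G\<^esub> = K" using K.subset by (simp add: coset_mult_one)
  have L: "\<exists>!x. x \<in> carrier G \<and> a \<otimes>\<^bsub>G\<^esub> x \<otimes>\<^bsub>G\<^esub> ?m a x = b"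
    if ab: "a \<in> carrier G" "b \<in> carrier G" for a b
  proof (rule ex1I)
    let ?c = "inv\<^bsub>G\<^esub> a \<otimes>\<^bsub>G\<^esub> b"
    let ?x = "?c \<otimes>\<^bsub>G\<^esub> inv\<^bsub>G\<^esub> (?m a ?c)"
    have c: "?c \<in> carrier G" using ab by simp
    have z: "?m a ?c \<in> Z" using mZ ab c by blast
    have "?m a ?x = ?m a ?c" using mr ab c iZ z by blast
    then show "?x \<in> carrier G \<and> a \<otimes>\<^bsub>G\<^esub> ?x \<otimes>\<^bsub>G\<^esub> ?m a ?x = b"
      using ab c ZG[OF z] by (simp add: m_assoc) (simp add: m_assoc[symmetric])
    fix x assume x: "x \<in> carrier G \<and> a \<otimes>\<^bsub>G\<^esub> x \<otimes>\<^bsub>G\<^esub> ?m a x = b"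
    have zx: "?m a x \<in> Z" using x ab mZ by blast
    have "b = a \<otimes>\<^bsub>G\<^esub> (x \<otimes>\<^bsub>G\<^esub> ?m a x)" using x ab ZG[OF zx] by (metis m_assoc)
    then have "?c = inv\<^bsub>G\<^esub> a \<otimes>\<^bsub>G\<^esub> (a \<otimes>\<^bsub>G\<^esub> (x \<otimes>\<^bsub>G\<^esub> ?m a x))" by (rule arg_cong)
    also have "\<dots> = x \<otimes>\<^bsub>G\<^esub> ?m a x"
      using conjunct1[OF x] ab ZG[OF zx] by (simp add: m_assoc[symmetric])
    finally have cx: "?c = x \<otimes>\<^bsub>G\<^esub> ?m a x" .
    then have "?m a ?c = ?m a x" using mr[OF ab(1) conjunct1[OF x] zx] by simp
    then have "?x = (x \<otimes>\<^bsub>G\<^esub> ?m a x) \<otimes>\<^bsub>G\<^esub> inv\<^bsub>G\<^esub> (?m a x)" using cx by simp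
    then show "x = ?x" using conjunct1[OF x] ZG[OF zx] by (simp add: m_assoc)
  qed
  have R: "\<exists>!x. x \<in> carrier G \<and> x \<otimes>\<^bsub>G\<^esub> a \<otimes>\<^bsub>G\<^esub> ?m x a = b"
    if ab: "a \<in> carrier G" "b \<in> carrier G" for a b
  proof (rule ex1I)
    let ?c = "b \<otimes>\<^bsub>G\<^esub> inv\<^bsub>G\<^esub> a"
    let ?x = "?c \<otimes>\<^bsub>G\<^esub> inv\<^bsub>G\<^esub> (?m ?c a)"
    have c: "?c \<in> carrier G" using ab by simp
    have z: "?m ?c a \<in> Z" using mZ ab c by blast
    have e: "?m ?x a = ?m ?c a" using ml ab c iZ z by blast
    have "?x \<otimes>\<^bsub>G\<^esub> a \<otimes>\<^bsub>G\<^esub> ?m ?c a = b \<otimes>\<^bsub>G\<^esub> inv\<^bsub>G\<^esub> a \<otimes>\<^bsub>G\<^esub> (inv\<^bsub>G\<^esub> (?m ?c a) \<otimes>\<^bsub>G\<^esub> (a \<otimes>\<^bsub>G\<^esub> ?m ?c a))"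
      using ab c ZG[OF z] by (simp add: m_assoc)
    also have "a \<otimes>\<^bsub>G\<^esub> ?m ?c a = ?m ?c a \<otimes>\<^bsub>G\<^esub> a" using com z ab by simp
    also have "inv\<^bsub>G\<^esub> (?m ?c a) \<otimes>\<^bsub>G\<^esub> (?m ?c a \<otimes>\<^bsub>G\<^esub> a) = a"
      using ab ZG[OF z] by (simp add: m_assoc[symmetric])
    also have "b \<otimes>\<^bsub>G\<^esub> inv\<^bsub>G\<^esub> a \<otimes>\<^bsub>G\<^esub> a = b" using ab by (simp add: m_assoc)
    finally show "?x \<in> carrier G \<and> ?x \<otimes>\<^bsub>G\<^esub> a \<otimes>\<^bsub>G\<^esub> ?m ?x a = b"
      using e c ZG[OF z] by simp
    fix x assume x: "x \<in> carrier G \<and> x \<otimes>\<^bsub>G\<^esub> a \<otimes>\<^bsub>G\<^esub> ?m x a = b"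
    have zx: "?m x a \<in> Z" using x ab mZ by blast
    have xc: "x \<in> carrier G" and mc: "?m x a \<in> carrier G" using x ZG[OF zx] by auto
    have "b = x \<otimes>\<^bsub>G\<^esub> (a \<otimes>\<^bsub>G\<^esub> ?m x a)"
      using m_assoc[OF xc ab(1) mc] conjunct2[OF x] by simp
    also have "a \<otimes>\<^bsub>G\<^esub> ?m x a = ?m x a \<otimes>\<^bsub>G\<^esub> a" using com[OF zx ab(1)] by simp
    also have "x \<otimes>\<^bsub>G\<^esub> (?m x a \<otimes>\<^bsub>G\<^esub> a) = x \<otimes>\<^bsub>G\<^esub> ?m x a \<otimes>\<^bsub>G\<^esub> a"
      using m_assoc[OF xc mc ab(1)] by simp
    finally have "?c = (x \<otimes>\<^bsub>G\<^esub> ?m x a \<otimes>\<^bsub>G\<^esub> a) \<otimes>\<^bsub>G\<^esub> inv\<^bsub>G\<^esub> a" by (rule arg_cong)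
    also have "\<dots> = x \<otimes>\<^bsub>G\<^esub> ?m x a" using xc mc ab by (simp add: m_assoc)
    finally have cx: "?c = x \<otimes>\<^bsub>G\<^esub> ?m x a" .
    then have "?m ?c a = ?m x a" using ml[OF xc ab(1) zx] by simp
    then have "?x = (x \<otimes>\<^bsub>G\<^esub> ?m x a) \<otimes>\<^bsub>G\<^esub> inv\<^bsub>G\<^esub> (?m x a)" using cx by simp
    then show "x = ?x" using xc mc by (simp add: m_assoc)
  qed
  have one: "?m \<one>\<^bsub>G\<^esub> x = \<one>\<^bsub>G\<^esub>" "?m x \<one>\<^bsub>G\<^esub> = \<one>\<^bsub>G\<^esub>" if "x \<in> carrier G" for x
    using \<mu>1[OF that] K1 unfolding mu_lift_def by auto
  show ?thesis
    unfolding is_loop_def mu_loop_def using L R one mZ ZG by auto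
qed

lemma loop_assoc_eq_one_iff:
  assumes Q: "is_loop Q" and x: "x \<in> carrier Q" "y \<in> carrier Q" "z \<in> carrier Q"
  shows "loop_assoc Q x y z = \<one>\<^bsub>Q\<^esub> \<longleftrightarrow> (x \<otimes>\<^bsub>Q\<^esub> y) \<otimes>\<^bsub>Q\<^esub> z = x \<otimes>\<^bsub>Q\<^esub> (y \<otimes>\<^bsub>Q\<^esub> z)"
proof -
  note L = is_loopD[OF Q]
  have *: "x \<otimes>\<^bsub>Q\<^esub> (y \<otimes>\<^bsub>Q\<^esub> z) \<in> carrier Q" "(x \<otimes>\<^bsub>Q\<^esub> y) \<otimes>\<^bsub>Q\<^esub> z \<in> carrier Q"
    using x L by auto
  have ex: "\<exists>!u. u \<in> carrier Q \<and> (x \<otimes>\<^bsub>Q\<^esub> y) \<otimes>\<^bsub>Q\<^esub> z = (x \<otimes>\<^bsub>Q\<^esub> (y \<otimes>\<^bsub>Q\<^esub> z)) \<otimes>\<^bsub>Q\<^esub> u"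
    using L(5)[OF *] by metis
  have one: "\<one>\<^bsub>Q\<^esub> \<in> carrier Q" "(x \<otimes>\<^bsub>Q\<^esub> (y \<otimes>\<^bsub>Q\<^esub> z)) \<otimes>\<^bsub>Q\<^esub> \<one>\<^bsub>Q\<^esub> = x \<otimes>\<^bsub>Q\<^esub> (y \<otimes>\<^bsub>Q\<^esub> z)"
    using L(2) L(4)[OF *(1)] by auto
  show ?thesis
  proof
    assume "loop_assoc Q x y z = \<one>\<^bsub>Q\<^esub>"
    then show "(x \<otimes>\<^bsub>Q\<^esub> y) \<otimes>\<^bsub>Q\<^esub> z = x \<otimes>\<^bsub>Q\<^esub> (y \<otimes>\<^bsub>Q\<^esub> z)"
      using theI'[OF ex] one(2) unfolding loop_assoc_def by simp
  next
    assume "(x \<otimes>\<^bsub>Q\<^esub> y) \<otimes>\<^bsub>Q\<^esub> z = x \<otimes>\<^bsub>Q\<^esub> (y \<otimes>\<^bsub>Q\<^esub> z)"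
    then show "loop_assoc Q x y z = \<one>\<^bsub>Q\<^esub>"
      using the1_equality[OF ex, of "\<one>\<^bsub>Q\<^esub>"] one unfolding loop_assoc_def by simp
  qed
qed

lemma loop_center_iff:
  assumes Q: "is_loop Q"
  shows "c \<in> loop_center Q \<longleftrightarrow> c \<in> carrier Q \<and>
    (\<forall>y \<in> carrier Q. \<forall>z \<in> carrier Q.
       (c \<otimes>\<^bsub>Q\<^esub> y) \<otimes>\<^bsub>Q\<^esub> z = c \<otimes>\<^bsub>Q\<^esub> (y \<otimes>\<^bsub>Q\<^esub> z) \<and> (y \<otimes>\<^bsub>Q\<^esub> c) \<otimes>\<^bsub>Q\<^esub> z = y \<otimes>\<^bsub>Q\<^esub> (c \<otimes>\<^bsub>Q\<^esub> z) \<and>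
       (y \<otimes>\<^bsub>Q\<^esub> z) \<otimes>\<^bsub>Q\<^esub> c = y \<otimes>\<^bsub>Q\<^esub> (z \<otimes>\<^bsub>Q\<^esub> c)) \<and>
    (\<forall>y \<in> carrier Q. c \<otimes>\<^bsub>Q\<^esub> y = y \<otimes>\<^bsub>Q\<^esub> c)"
proof -
  have "c \<in> loop_nucleus Q \<longleftrightarrow> c \<in> carrier Q \<and>
    (\<forall>y \<in> carrier Q. \<forall>z \<in> carrier Q.
       (c \<otimes>\<^bsub>Q\<^esub> y) \<otimes>\<^bsub>Q\<^esub> z = c \<otimes>\<^bsub>Q\<^esub> (y \<otimes>\<^bsub>Q\<^esub> z) \<and> (y \<otimes>\<^bsub>Q\<^esub> c) \<otimes>\<^bsub>Q\<^esub> z = y \<otimes>\<^bsub>Q\<^esub> (c \<otimes>\<^bsub>Q\<^esub> z) \<and>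
       (y \<otimes>\<^bsub>Q\<^esub> z) \<otimes>\<^bsub>Q\<^esub> c = y \<otimes>\<^bsub>Q\<^esub> (z \<otimes>\<^bsub>Q\<^esub> c))"
    unfolding loop_nucleus_def mem_Collect_eq
    by (intro conj_cong ball_cong refl; simp only: loop_assoc_eq_one_iff[OF Q])
  then show ?thesis unfolding loop_center_def by blast
qed

lemma loop_center_group:
  assumes "group G"
  shows "loop_center G = group_center G"
proof -
  interpret group G by fact
  show ?thesis
    unfolding set_eq_iff loop_center_iff[OF is_loop_group[OF assms]] group_center_def mem_Collect_eq
    using m_assoc by blast
qed

lemma loop_centerD:
  assumes "is_loop Q" "c \<in> loop_center Q"
  shows "c \<in> carrier Q"
    and "\<And>y z. y \<in> carrier Q \<Longrightarrow> z \<in> carrier Q \<Longrightarrow> (c \<otimes>\<^bsub>Q\<^esub> y) \<otimes>\<^bsub>Q\<^esub> z = c \<otimes>\<^bsub>Q\<^esub> (y \<otimes>\<^bsub>Q\<^esub> z)"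
    and "\<And>y z. y \<in> carrier Q \<Longrightarrow> z \<in> carrier Q \<Longrightarrow> (y \<otimes>\<^bsub>Q\<^esub> c) \<otimes>\<^bsub>Q\<^esub> z = y \<otimes>\<^bsub>Q\<^esub> (c \<otimes>\<^bsub>Q\<^esub> z)"
    and "\<And>y z. y \<in> carrier Q \<Longrightarrow> z \<in> carrier Q \<Longrightarrow> (y \<otimes>\<^bsub>Q\<^esub> z) \<otimes>\<^bsub>Q\<^esub> c = y \<otimes>\<^bsub>Q\<^esub> (z \<otimes>\<^bsub>Q\<^esub> c)"
    and "\<And>y. y \<in> carrier Q \<Longrightarrow> c \<otimes>\<^bsub>Q\<^esub> y = y \<otimes>\<^bsub>Q\<^esub> c"
  using assms(2) unfolding loop_center_iff[OF assms(1)] by blast+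

lemma loop_center_one:
  assumes "is_loop Q" shows "\<one>\<^bsub>Q\<^esub> \<in> loop_center Q"
  using is_loopD(1-4)[OF assms] by (simp add: loop_center_iff[OF assms])

lemma loop_center_closed:
  assumes Q: "is_loop Q" and z: "z \<in> loop_center Q" and w: "w \<in> loop_center Q"
  shows "z \<otimes>\<^bsub>Q\<^esub> w \<in> loop_center Q"
proof -
  note L = is_loopD(1)[OF Q] and Z = loop_centerD[OF Q z] and W = loop_centerD[OF Q w]
  have "((z \<otimes>\<^bsub>Q\<^esub> w) \<otimes>\<^bsub>Q\<^esub> y) \<otimes>\<^bsub>Q\<^esub> v = (z \<otimes>\<^bsub>Q\<^esub> w) \<otimes>\<^bsub>Q\<^esub> (y \<otimes>\<^bsub>Q\<^esub> v)" if "y \<in> carrier Q" "v \<in> carrier Q" for y v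
    using that L Z(1,2) W(1,2) by simp
  moreover have "(y \<otimes>\<^bsub>Q\<^esub> (z \<otimes>\<^bsub>Q\<^esub> w)) \<otimes>\<^bsub>Q\<^esub> v = y \<otimes>\<^bsub>Q\<^esub> ((z \<otimes>\<^bsub>Q\<^esub> w) \<otimes>\<^bsub>Q\<^esub> v)" if "y \<in> carrier Q" "v \<in> carrier Q" for y v
  proof -
    have "(y \<otimes>\<^bsub>Q\<^esub> (z \<otimes>\<^bsub>Q\<^esub> w)) \<otimes>\<^bsub>Q\<^esub> v = ((y \<otimes>\<^bsub>Q\<^esub> z) \<otimes>\<^bsub>Q\<^esub> w) \<otimes>\<^bsub>Q\<^esub> v" using that W(1) Z(3) by simp
    also have "\<dots> = (y \<otimes>\<^bsub>Q\<^esub> z) \<otimes>\<^bsub>Q\<^esub> (w \<otimes>\<^bsub>Q\<^esub> v)" using that L Z(1) W(3) by simp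
    also have "\<dots> = y \<otimes>\<^bsub>Q\<^esub> (z \<otimes>\<^bsub>Q\<^esub> (w \<otimes>\<^bsub>Q\<^esub> v))" using that L W(1) Z(3) by simp
    finally show ?thesis using that W(1) Z(2) by simp
  qed
  moreover have "(y \<otimes>\<^bsub>Q\<^esub> v) \<otimes>\<^bsub>Q\<^esub> (z \<otimes>\<^bsub>Q\<^esub> w) = y \<otimes>\<^bsub>Q\<^esub> (v \<otimes>\<^bsub>Q\<^esub> (z \<otimes>\<^bsub>Q\<^esub> w))" if "y \<in> carrier Q" "v \<in> carrier Q" for y v
  proof -
    have "(y \<otimes>\<^bsub>Q\<^esub> v) \<otimes>\<^bsub>Q\<^esub> (z \<otimes>\<^bsub>Q\<^esub> w) = ((y \<otimes>\<^bsub>Q\<^esub> v) \<otimes>\<^bsub>Q\<^esub> z) \<otimes>\<^bsub>Q\<^esub> w" using that L Z(1) W(4) by simp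
    also have "\<dots> = (y \<otimes>\<^bsub>Q\<^esub> (v \<otimes>\<^bsub>Q\<^esub> z)) \<otimes>\<^bsub>Q\<^esub> w" using that Z(4) by simp
    also have "\<dots> = y \<otimes>\<^bsub>Q\<^esub> ((v \<otimes>\<^bsub>Q\<^esub> z) \<otimes>\<^bsub>Q\<^esub> w)" using that L Z(1) W(4) by simp
    finally show ?thesis using that L Z(1) W(4) by simp
  qed
  moreover have "(z \<otimes>\<^bsub>Q\<^esub> w) \<otimes>\<^bsub>Q\<^esub> y = y \<otimes>\<^bsub>Q\<^esub> (z \<otimes>\<^bsub>Q\<^esub> w)" if "y \<in> carrier Q" for y
  proof -
    have "(z \<otimes>\<^bsub>Q\<^esub> w) \<otimes>\<^bsub>Q\<^esub> y = z \<otimes>\<^bsub>Q\<^esub> (y \<otimes>\<^bsub>Q\<^esub> w)" using that W(1,5) Z(2) by simp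
    also have "\<dots> = (y \<otimes>\<^bsub>Q\<^esub> z) \<otimes>\<^bsub>Q\<^esub> w" using that W(1) Z(2)[of y w] Z(5) by simp
    finally show ?thesis using that W(1) Z(3) by simp
  qed
  ultimately show ?thesis using L[OF Z(1) W(1)] unfolding loop_center_iff[OF Q] by blast
qed

lemma loop_center_inv:
  assumes Q: "is_loop Q" and z: "z \<in> loop_center Q"
  obtains u where "u \<in> loop_center Q" "u \<otimes>\<^bsub>Q\<^esub> z = \<one>\<^bsub>Q\<^esub>"
proof -
  note L = is_loopD(1)[OF Q] and I = is_loopD(2-4)[OF Q] and Z = loop_centerD[OF Q z]
  obtain u where u: "u \<in> carrier Q" "z \<otimes>\<^bsub>Q\<^esub> u = \<one>\<^bsub>Q\<^esub>"
    using is_loopD(5)[OF Q Z(1) I(1)] by blast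
  have zu: "z \<otimes>\<^bsub>Q\<^esub> (u \<otimes>\<^bsub>Q\<^esub> y) = y" if "y \<in> carrier Q" for y
    using Z(2)[OF u(1) that] u I that by simp
  have zyu: "z \<otimes>\<^bsub>Q\<^esub> (y \<otimes>\<^bsub>Q\<^esub> u) = y" if "y \<in> carrier Q" for y
    using Z(2)[OF that u(1)] Z(3)[OF that u(1)] Z(5)[OF that] u I that by simp
  have zy: "z \<otimes>\<^bsub>Q\<^esub> (y \<otimes>\<^bsub>Q\<^esub> w) = y \<otimes>\<^bsub>Q\<^esub> (z \<otimes>\<^bsub>Q\<^esub> w)" if "y \<in> carrier Q" "w \<in> carrier Q" for y w
    using Z(2)[OF that] Z(3)[OF that] Z(5)[OF that(1)] by simp
  note C = is_loop_lcancel[OF Q Z(1)]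
  have "(u \<otimes>\<^bsub>Q\<^esub> y) \<otimes>\<^bsub>Q\<^esub> v = u \<otimes>\<^bsub>Q\<^esub> (y \<otimes>\<^bsub>Q\<^esub> v)" if "y \<in> carrier Q" "v \<in> carrier Q" for y v
  proof -
    have "z \<otimes>\<^bsub>Q\<^esub> ((u \<otimes>\<^bsub>Q\<^esub> y) \<otimes>\<^bsub>Q\<^esub> v) = y \<otimes>\<^bsub>Q\<^esub> v" using Z(2)[OF L[OF u(1) that(1)] that(2)] zu that by simp
    then show ?thesis using zu L that u by - (rule C; simp)
  qed
  moreover have "(y \<otimes>\<^bsub>Q\<^esub> u) \<otimes>\<^bsub>Q\<^esub> v = y \<otimes>\<^bsub>Q\<^esub> (u \<otimes>\<^bsub>Q\<^esub> v)" if "y \<in> carrier Q" "v \<in> carrier Q" for y v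
  proof -
    have "z \<otimes>\<^bsub>Q\<^esub> ((y \<otimes>\<^bsub>Q\<^esub> u) \<otimes>\<^bsub>Q\<^esub> v) = y \<otimes>\<^bsub>Q\<^esub> v" using Z(2)[OF L[OF that(1) u(1)] that(2)] zyu that by simp
    moreover have "z \<otimes>\<^bsub>Q\<^esub> (y \<otimes>\<^bsub>Q\<^esub> (u \<otimes>\<^bsub>Q\<^esub> v)) = y \<otimes>\<^bsub>Q\<^esub> v" using zy[OF that(1) L[OF u(1) that(2)]] zu that by simp
    ultimately show ?thesis using L that u by - (rule C; simp)
  qed
  moreover have "(y \<otimes>\<^bsub>Q\<^esub> v) \<otimes>\<^bsub>Q\<^esub> u = y \<otimes>\<^bsub>Q\<^esub> (v \<otimes>\<^bsub>Q\<^esub> u)" if "y \<in> carrier Q" "v \<in> carrier Q" for y v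
  proof -
    have "z \<otimes>\<^bsub>Q\<^esub> (y \<otimes>\<^bsub>Q\<^esub> (v \<otimes>\<^bsub>Q\<^esub> u)) = y \<otimes>\<^bsub>Q\<^esub> v" using zy[OF that(1) L[OF that(2) u(1)]] zyu that by simp
    then show ?thesis using zyu L that u by - (rule C; simp)
  qed
  moreover have uc: "u \<otimes>\<^bsub>Q\<^esub> y = y \<otimes>\<^bsub>Q\<^esub> u" if "y \<in> carrier Q" for y
    using zu zyu L that u by - (rule C; simp)
  ultimately have "u \<in> loop_center Q" using u(1) unfolding loop_center_iff[OF Q] by blast
  moreover have "u \<otimes>\<^bsub>Q\<^esub> z = \<one>\<^bsub>Q\<^esub>" using uc[OF Z(1)] u by simp
  ultimately show ?thesis using that by blast
qed

lemma center_coset_mem: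
  "b \<in> loop_center Q #>\<^bsub>Q\<^esub> a \<longleftrightarrow> (\<exists>z \<in> loop_center Q. b = z \<otimes>\<^bsub>Q\<^esub> a)"
  unfolding r_coset_def by auto

lemma center_coset_self:
  assumes Q: "is_loop Q" and a: "a \<in> carrier Q"
  shows "a \<in> loop_center Q #>\<^bsub>Q\<^esub> a"
  using loop_center_one[OF Q] is_loopD(3)[OF Q a] by (auto simp: center_coset_mem intro: bexI[of _ "\<one>\<^bsub>Q\<^esub>"])

lemma center_coset_shift:
  assumes Q: "is_loop Q" and a: "a \<in> carrier Q" and z: "z \<in> loop_center Q"
  shows "loop_center Q #>\<^bsub>Q\<^esub> (z \<otimes>\<^bsub>Q\<^esub> a) = loop_center Q #>\<^bsub>Q\<^esub> a"
proof (intro equalityI subsetI)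
  fix b assume "b \<in> loop_center Q #>\<^bsub>Q\<^esub> (z \<otimes>\<^bsub>Q\<^esub> a)"
  then obtain w where w: "w \<in> loop_center Q" "b = w \<otimes>\<^bsub>Q\<^esub> (z \<otimes>\<^bsub>Q\<^esub> a)"
    by (auto simp: center_coset_mem)
  then have "b = (w \<otimes>\<^bsub>Q\<^esub> z) \<otimes>\<^bsub>Q\<^esub> a"
    using loop_centerD(2)[OF Q w(1)] loop_centerD(1)[OF Q z] a by simp
  then show "b \<in> loop_center Q #>\<^bsub>Q\<^esub> a"
    using loop_center_closed[OF Q w(1) z] by (auto simp: center_coset_mem)
next
  fix b assume "b \<in> loop_center Q #>\<^bsub>Q\<^esub> a"
  then obtain w where w: "w \<in> loop_center Q" "b = w \<otimes>\<^bsub>Q\<^esub> a" by (auto simp: center_coset_mem)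
  obtain u where u: "u \<in> loop_center Q" "u \<otimes>\<^bsub>Q\<^esub> z = \<one>\<^bsub>Q\<^esub>" using loop_center_inv[OF Q z] .
  have za: "z \<in> carrier Q" "z \<otimes>\<^bsub>Q\<^esub> a \<in> carrier Q"
    using loop_centerD(1)[OF Q z] a is_loopD(1)[OF Q] by auto
  have "u \<otimes>\<^bsub>Q\<^esub> (z \<otimes>\<^bsub>Q\<^esub> a) = a"
    using loop_centerD(2)[OF Q u(1) za(1) a] u(2) is_loopD(3)[OF Q a] by simp
  then have "b = (w \<otimes>\<^bsub>Q\<^esub> u) \<otimes>\<^bsub>Q\<^esub> (z \<otimes>\<^bsub>Q\<^esub> a)"
    using w loop_centerD(2)[OF Q w(1) loop_centerD(1)[OF Q u(1)] za(2)] by simp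
  then show "b \<in> loop_center Q #>\<^bsub>Q\<^esub> (z \<otimes>\<^bsub>Q\<^esub> a)"
    using loop_center_closed[OF Q w(1) u(1)] by (auto simp: center_coset_mem)
qed

lemma center_coset_eq_iff:
  assumes Q: "is_loop Q" and a: "a \<in> carrier Q" and b: "b \<in> carrier Q"
  shows "loop_center Q #>\<^bsub>Q\<^esub> a = loop_center Q #>\<^bsub>Q\<^esub> b \<longleftrightarrow> (\<exists>z \<in> loop_center Q. b = z \<otimes>\<^bsub>Q\<^esub> a)"
proof
  assume "loop_center Q #>\<^bsub>Q\<^esub> a = loop_center Q #>\<^bsub>Q\<^esub> b"
  then have "b \<in> loop_center Q #>\<^bsub>Q\<^esub> a" using center_coset_self[OF Q b] by blast
  then show "\<exists>z \<in> loop_center Q. b = z \<otimes>\<^bsub>Q\<^esub> a" by (simp only: center_coset_mem)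
next
  assume "\<exists>z \<in> loop_center Q. b = z \<otimes>\<^bsub>Q\<^esub> a"
  then show "loop_center Q #>\<^bsub>Q\<^esub> a = loop_center Q #>\<^bsub>Q\<^esub> b"
    using center_coset_shift[OF Q a] by force
qed

lemma center_coset_mult:
  assumes Q: "is_loop Q" and a: "a \<in> carrier Q" and b: "b \<in> carrier Q"
  shows "(loop_center Q #>\<^bsub>Q\<^esub> a) <#>\<^bsub>Q\<^esub> (loop_center Q #>\<^bsub>Q\<^esub> b) = loop_center Q #>\<^bsub>Q\<^esub> (a \<otimes>\<^bsub>Q\<^esub> b)"
proof -
  note L = is_loopD(1)[OF Q]
  have *: "(z \<otimes>\<^bsub>Q\<^esub> a) \<otimes>\<^bsub>Q\<^esub> (w \<otimes>\<^bsub>Q\<^esub> b) = (z \<otimes>\<^bsub>Q\<^esub> w) \<otimes>\<^bsub>Q\<^esub> (a \<otimes>\<^bsub>Q\<^esub> b)"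
    if z: "z \<in> loop_center Q" and w: "w \<in> loop_center Q" for z w
  proof -
    note Z = loop_centerD[OF Q z] and W = loop_centerD[OF Q w]
    have "(z \<otimes>\<^bsub>Q\<^esub> a) \<otimes>\<^bsub>Q\<^esub> (w \<otimes>\<^bsub>Q\<^esub> b) = z \<otimes>\<^bsub>Q\<^esub> (a \<otimes>\<^bsub>Q\<^esub> (w \<otimes>\<^bsub>Q\<^esub> b))"
      using a b W(1) L by (intro Z(2)) auto
    also have "a \<otimes>\<^bsub>Q\<^esub> (w \<otimes>\<^bsub>Q\<^esub> b) = (w \<otimes>\<^bsub>Q\<^esub> a) \<otimes>\<^bsub>Q\<^esub> b" using W(3)[OF a b] W(5)[OF a] by simp
    also have "\<dots> = w \<otimes>\<^bsub>Q\<^esub> (a \<otimes>\<^bsub>Q\<^esub> b)" by (rule W(2)[OF a b])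
    also have "z \<otimes>\<^bsub>Q\<^esub> \<dots> = (z \<otimes>\<^bsub>Q\<^esub> w) \<otimes>\<^bsub>Q\<^esub> (a \<otimes>\<^bsub>Q\<^esub> b)" using Z(2)[OF W(1)] L a b by simp
    finally show ?thesis .
  qed
  have ab: "a \<otimes>\<^bsub>Q\<^esub> b \<in> carrier Q" using L a b .
  show ?thesis
  proof (intro equalityI subsetI)
    fix c assume "c \<in> (loop_center Q #>\<^bsub>Q\<^esub> a) <#>\<^bsub>Q\<^esub> (loop_center Q #>\<^bsub>Q\<^esub> b)"
    then obtain z w where "z \<in> loop_center Q" "w \<in> loop_center Q"
      "c = (z \<otimes>\<^bsub>Q\<^esub> a) \<otimes>\<^bsub>Q\<^esub> (w \<otimes>\<^bsub>Q\<^esub> b)"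
      by (auto simp: set_mult_def center_coset_mem)
    then show "c \<in> loop_center Q #>\<^bsub>Q\<^esub> (a \<otimes>\<^bsub>Q\<^esub> b)"
      using * loop_center_closed[OF Q] by (auto simp: center_coset_mem)
  next
    fix c assume "c \<in> loop_center Q #>\<^bsub>Q\<^esub> (a \<otimes>\<^bsub>Q\<^esub> b)"
    then obtain z where z: "z \<in> loop_center Q" "c = z \<otimes>\<^bsub>Q\<^esub> (a \<otimes>\<^bsub>Q\<^esub> b)"
      by (auto simp: center_coset_mem)
    then have "c = (z \<otimes>\<^bsub>Q\<^esub> a) \<otimes>\<^bsub>Q\<^esub> b" using loop_centerD(2)[OF Q z(1) a b] by simp
    then show "c \<in> (loop_center Q #>\<^bsub>Q\<^esub> a) <#>\<^bsub>Q\<^esub> (loop_center Q #>\<^bsub>Q\<^esub> b)"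
      using center_coset_self[OF Q b] center_coset_mem[of "z \<otimes>\<^bsub>Q\<^esub> a" Q a] z(1)
      unfolding set_mult_def by blast
  qed
qed

lemma is_loop_center_quotient:
  assumes Q: "is_loop Q"
  shows "is_loop (Q Mod loop_center Q)"
proof -
  let ?c = "\<lambda>a. loop_center Q #>\<^bsub>Q\<^esub> a"
  note L = is_loopD[OF Q]
  have car: "carrier (Q Mod loop_center Q) = ?c ` carrier Q"
    unfolding FactGroup_def RCOSETS_def by auto
  have one: "\<one>\<^bsub>Q Mod loop_center Q\<^esub> = ?c \<one>\<^bsub>Q\<^esub>"
    using L(4) loop_centerD(1)[OF Q] unfolding FactGroup_def r_coset_def by force
  have mul: "?c a \<otimes>\<^bsub>Q Mod loop_center Q\<^esub> ?c b = ?c (a \<otimes>\<^bsub>Q\<^esub> b)"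
    if "a \<in> carrier Q" "b \<in> carrier Q" for a b
    using center_coset_mult[OF Q that] unfolding FactGroup_def by simp
  have div1: "\<exists>!U. U \<in> ?c ` carrier Q \<and> ?c a \<otimes>\<^bsub>Q Mod loop_center Q\<^esub> U = ?c b"
    if ab: "a \<in> carrier Q" "b \<in> carrier Q" for a b
  proof -
    obtain x where x: "x \<in> carrier Q" "a \<otimes>\<^bsub>Q\<^esub> x = b" using L(5)[OF ab] by blast
    show ?thesis
    proof (rule ex1I[of _ "?c x"])
      show "?c x \<in> ?c ` carrier Q \<and> ?c a \<otimes>\<^bsub>Q Mod loop_center Q\<^esub> ?c x = ?c b"
        using x ab mul by auto
      fix U assume "U \<in> ?c ` carrier Q \<and> ?c a \<otimes>\<^bsub>Q Mod loop_center Q\<^esub> U = ?c b"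
      then obtain y where y: "y \<in> carrier Q" "U = ?c y" "?c (a \<otimes>\<^bsub>Q\<^esub> y) = ?c b"
        using mul ab by auto
      obtain z where z: "z \<in> loop_center Q" "b = z \<otimes>\<^bsub>Q\<^esub> (a \<otimes>\<^bsub>Q\<^esub> y)"
        using y(3) center_coset_eq_iff[OF Q] L(1)[OF ab(1) y(1)] ab(2) by force
      note Zc = loop_centerD[OF Q z(1)]
      have "b = a \<otimes>\<^bsub>Q\<^esub> (z \<otimes>\<^bsub>Q\<^esub> y)"
        using z(2) Zc(2)[OF ab(1) y(1)] Zc(3)[OF ab(1) y(1)] Zc(5)[OF ab(1)] by simp
      then have "x = z \<otimes>\<^bsub>Q\<^esub> y"
        using is_loop_lcancel[OF Q ab(1) x(1)] x(2) L(1)[OF Zc(1) y(1)] by simp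
      then show "U = ?c x" using y center_coset_shift[OF Q y(1) z(1)] by simp
    qed
  qed
  have div2: "\<exists>!U. U \<in> ?c ` carrier Q \<and> U \<otimes>\<^bsub>Q Mod loop_center Q\<^esub> ?c a = ?c b"
    if ab: "a \<in> carrier Q" "b \<in> carrier Q" for a b
  proof -
    obtain x where x: "x \<in> carrier Q" "x \<otimes>\<^bsub>Q\<^esub> a = b" using L(6)[OF ab] by blast
    show ?thesis
    proof (rule ex1I[of _ "?c x"])
      show "?c x \<in> ?c ` carrier Q \<and> ?c x \<otimes>\<^bsub>Q Mod loop_center Q\<^esub> ?c a = ?c b"
        using x ab mul by auto
      fix U assume "U \<in> ?c ` carrier Q \<and> U \<otimes>\<^bsub>Q Mod loop_center Q\<^esub> ?c a = ?c b"
      then obtain y where y: "y \<in> carrier Q" "U = ?c y" "?c (y \<otimes>\<^bsub>Q\<^esub> a) = ?c b"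
        using mul ab by auto
      obtain z where z: "z \<in> loop_center Q" "b = z \<otimes>\<^bsub>Q\<^esub> (y \<otimes>\<^bsub>Q\<^esub> a)"
        using y(3) center_coset_eq_iff[OF Q] L(1)[OF y(1) ab(1)] ab(2) by force
      note Zc = loop_centerD[OF Q z(1)]
      have "b = (z \<otimes>\<^bsub>Q\<^esub> y) \<otimes>\<^bsub>Q\<^esub> a" using z(2) Zc(2)[OF y(1) ab(1)] by simp
      then have "x = z \<otimes>\<^bsub>Q\<^esub> y"
        using is_loop_rcancel[OF Q ab(1) x(1)] x(2) L(1)[OF Zc(1) y(1)] by simp
      then show "U = ?c x" using y center_coset_shift[OF Q y(1) z(1)] by simp
    qed
  qed
  show ?thesis unfolding is_loop_def car one
    using mul div1 div2 L(1-4) by auto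
qed

lemma relabel_iso:
  assumes Q: "is_loop Q" and f: "inj_on f (carrier Q)"
  shows "f \<in> iso Q (relabel f Q)"
  using f is_loopD(1)[OF Q]
  by (auto simp: iso_def hom_def relabel_def bij_betw_def)

lemma is_loop_relabel:
  assumes Q: "is_loop Q" and f: "inj_on f (carrier Q)"
  shows "is_loop (relabel f Q)"
proof -
  note L = is_loopD[OF Q]
  have car: "carrier (relabel f Q) = f ` carrier Q" and one: "\<one>\<^bsub>relabel f Q\<^esub> = f \<one>\<^bsub>Q\<^esub>"
    unfolding relabel_def by auto
  have mul: "f a \<otimes>\<^bsub>relabel f Q\<^esub> f b = f (a \<otimes>\<^bsub>Q\<^esub> b)" if "a \<in> carrier Q" "b \<in> carrier Q" for a b
    using that f unfolding relabel_def by simp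
  have d1: "\<exists>!U. U \<in> f ` carrier Q \<and> f a \<otimes>\<^bsub>relabel f Q\<^esub> U = f b"
    if ab: "a \<in> carrier Q" "b \<in> carrier Q" for a b
  proof -
    obtain x where x: "x \<in> carrier Q" "a \<otimes>\<^bsub>Q\<^esub> x = b" using L(5)[OF ab] by blast
    show ?thesis
    proof (rule ex1I[of _ "f x"])
      show "f x \<in> f ` carrier Q \<and> f a \<otimes>\<^bsub>relabel f Q\<^esub> f x = f b" using x ab mul by auto
      fix W assume "W \<in> f ` carrier Q \<and> f a \<otimes>\<^bsub>relabel f Q\<^esub> W = f b"
      then obtain w where w: "w \<in> carrier Q" "W = f w" "f (a \<otimes>\<^bsub>Q\<^esub> w) = f b" using mul ab by auto
      have "a \<otimes>\<^bsub>Q\<^esub> w = b" using inj_onD[OF f w(3)] L(1) w(1) ab by blast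
      then have "w = x" using is_loop_lcancel[OF Q ab(1) w(1) x(1)] x(2) by simp
      then show "W = f x" using w by simp
    qed
  qed
  have d2: "\<exists>!U. U \<in> f ` carrier Q \<and> U \<otimes>\<^bsub>relabel f Q\<^esub> f a = f b"
    if ab: "a \<in> carrier Q" "b \<in> carrier Q" for a b
  proof -
    obtain x where x: "x \<in> carrier Q" "x \<otimes>\<^bsub>Q\<^esub> a = b" using L(6)[OF ab] by blast
    show ?thesis
    proof (rule ex1I[of _ "f x"])
      show "f x \<in> f ` carrier Q \<and> f x \<otimes>\<^bsub>relabel f Q\<^esub> f a = f b" using x ab mul by auto
      fix W assume "W \<in> f ` carrier Q \<and> W \<otimes>\<^bsub>relabel f Q\<^esub> f a = f b"
      then obtain w where w: "w \<in> carrier Q" "W = f w" "f (w \<otimes>\<^bsub>Q\<^esub> a) = f b" using mul ab by auto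
      have "w \<otimes>\<^bsub>Q\<^esub> a = b" using inj_onD[OF f w(3)] L(1) w(1) ab by blast
      then have "w = x" using is_loop_rcancel[OF Q ab(1) w(1) x(1)] x(2) by simp
      then show "W = f x" using w by simp
    qed
  qed
  show ?thesis unfolding is_loop_def car one using mul d1 d2 L(1-4) by auto
qed

lemma center_quotient_disjoint:
  assumes Q: "is_loop Q"
  shows "pairwise disjnt (carrier (Q Mod loop_center Q))"
    and "\<Union> (carrier (Q Mod loop_center Q)) = carrier Q"
    and "{} \<notin> carrier (Q Mod loop_center Q)"
proof -
  have car: "carrier (Q Mod loop_center Q) = (\<lambda>a. loop_center Q #>\<^bsub>Q\<^esub> a) ` carrier Q"
    unfolding FactGroup_def RCOSETS_def by auto
  have eq: "loop_center Q #>\<^bsub>Q\<^esub> c = loop_center Q #>\<^bsub>Q\<^esub> a"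
    if "a \<in> carrier Q" "c \<in> loop_center Q #>\<^bsub>Q\<^esub> a" for a c
    using that(2) center_coset_shift[OF Q that(1)] unfolding center_coset_mem by blast
  show "pairwise disjnt (carrier (Q Mod loop_center Q))"
    unfolding car pairwise_image pairwise_def disjnt_iff using eq by blast
  have "loop_center Q #>\<^bsub>Q\<^esub> a \<subseteq> carrier Q" if "a \<in> carrier Q" for a
    using loop_centerD(1)[OF Q] is_loopD(1)[OF Q _ that] unfolding r_coset_def by blast
  then show "\<Union> (carrier (Q Mod loop_center Q)) = carrier Q"
    using center_coset_self[OF Q] unfolding car by blast
  show "{} \<notin> carrier (Q Mod loop_center Q)"
    using center_coset_self[OF Q] unfolding car by blast
qed

lemma disjoint_blocks_Union:
  assumes B: "pairwise disjnt B" "{} \<notin> B" and C: "pairwise disjnt C" "{} \<notin> C" "\<Union> C = B"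
  shows "inj_on \<Union> C" and "pairwise disjnt (\<Union> ` C)" and "{} \<notin> \<Union> ` C"
proof -
  have eq: "U = Y" if U: "U \<in> C" "Y \<in> C" "\<not> disjnt (\<Union> U) (\<Union> Y)" for U Y
  proof -
    obtain S T t where S: "S \<in> U" "t \<in> S" "T \<in> Y" "t \<in> T"
      using U by (auto simp: disjnt_iff)
    then have "S = T" using B U C(3) by (metis UnionI disjnt_iff pairwiseD)
    then show ?thesis using S U C(1) by (metis disjnt_iff pairwiseD)
  qed
  have ne: "\<Union> U \<noteq> {}" if U: "U \<in> C" for U
    using U B C by (metis UnionI Union_empty_conv equals0I)
  show "inj_on \<Union> C" using eq ne by (intro inj_onI) (metis disjnt_self_iff_empty)
  show "pairwise disjnt (\<Union> ` C)" unfolding pairwise_image pairwise_def using eq by blast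
  show "{} \<notin> \<Union> ` C" using ne by auto
qed

lemma central_series_blocks:
  assumes Q: "is_loop Q"
  shows "is_loop (central_series Q i)"
    and "pairwise disjnt (carrier (central_series Q i))"
    and "{} \<notin> carrier (central_series Q i)"
proof -
  have "is_loop (central_series Q i) \<and> pairwise disjnt (carrier (central_series Q i)) \<and>
    {} \<notin> carrier (central_series Q i)"
  proof (induction i)
    case 0
    have "is_loop (relabel (\<lambda>x. {x}) Q)" by (rule is_loop_relabel[OF Q]) (auto simp: inj_on_def)
    then show ?case by (auto simp: relabel_def pairwise_def)
  next
    case (Suc i)
    let ?R = "central_series Q i"
    have R: "is_loop ?R" using Suc by simp
    have c: "carrier (relabel \<Union> (?R Mod loop_center ?R)) = \<Union> ` carrier (?R Mod loop_center ?R)"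
      unfolding relabel_def by simp
    have "inj_on \<Union> (carrier (?R Mod loop_center ?R))"
      "pairwise disjnt (\<Union> ` carrier (?R Mod loop_center ?R))"
      "{} \<notin> \<Union> ` carrier (?R Mod loop_center ?R)"
      using disjoint_blocks_Union[of "carrier ?R" "carrier (?R Mod loop_center ?R)"]
        Suc center_quotient_disjoint[OF R] by auto
    then show ?case
      using is_loop_relabel[OF is_loop_center_quotient[OF R], of \<Union>] c by simp
  qed
  then show "is_loop (central_series Q i)" "pairwise disjnt (carrier (central_series Q i))"
    "{} \<notin> carrier (central_series Q i)" by auto
qed

lemma central_series_iso:
  assumes Q: "is_loop Q"
  shows "(\<lambda>x. {x}) \<in> iso Q (central_series Q 0)"
    and "\<Union> \<in> iso (central_series Q i Mod loop_center (central_series Q i)) (central_series Q (Suc i))"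
proof -
  show "(\<lambda>x. {x}) \<in> iso Q (central_series Q 0)"
    using relabel_iso[OF Q, of "\<lambda>x. {x}"] by (auto simp: inj_on_def)
  let ?R = "central_series Q i"
  note R = central_series_blocks[OF Q, of i]
  have "inj_on \<Union> (carrier (?R Mod loop_center ?R))"
    using disjoint_blocks_Union(1)[of "carrier ?R" "carrier (?R Mod loop_center ?R)"]
      R center_quotient_disjoint[OF R(1)] by auto
  then show "\<Union> \<in> iso (?R Mod loop_center ?R) (central_series Q (Suc i))"
    using relabel_iso[OF is_loop_center_quotient[OF R(1)], of \<Union>] by simp
qed

end

theory Submission
  imports Defs
begin

text \<open>
  The map in question is the form \<open>(x, y, z) \<mapsto> \<delta>([x,y], z)\<close> on \<open>G\<close> itself. Since \<open>G\<close> has class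
  two, \<open>[x,y]\<close> is central and additive in each argument, so \<open>z\<^bsup>yx\<^esup> = z\<^bsup>xy\<^esup>\<close> and the identity for
  \<open>\<delta>\<close> collapses to \<open>\<delta>([z,y], x) = \<delta>([z,x], y)\<close>: the form is symmetric in its last two arguments
  (\<open>form_swap23\<close>). On the other hand \<open>[y,x] = [x,y]\<inverse>\<close> makes it antisymmetric in the first two
  (\<open>form_antisym\<close>). Now \<open>(1 3) = (2 3)(1 2)(2 3) = (1 2)(2 3)(1 2)\<close>; the first product changes the
  sign of the form once, the second twice. So the sign is immaterial: the values have square one
  and the form is symmetric in all arguments (\<open>form_swap13\<close>, \<open>form_square\<close>).

  The form is trivial when the first argument lies in \<open>N\<close>, because then the commutator falls into
  \<open>K\<close>, where \<open>\<mu>\<close> is trivial; by symmetry and additivity it depends only on the cosets of \<open>N\<close>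
  (\<open>form_coset\<close>). As target group one can take all elements of \<open>Z\<close> whose square is one.

  Nontriviality is where the class of the loop enters. If \<open>\<delta>([x,y], z) = 1\<close> throughout, then each
  commutator of \<open>G\<close> lies in the center of the loop: it associates with everything because it
  belongs to \<open>N\<close>, where \<open>\<mu>\<close> is additive, and it commutes with everything because \<open>\<delta>\<close> is trivial on
  it (\<open>mu_loop_center\<close>). The elements of \<open>Z\<close> are central in the loop too, so the quotient of the
  loop by its center is an abelian group and its class is at most two, not three
  (\<open>mu_loop_class_le_two\<close>).
\<close>

section \<open>Nilpotency class at most two, read off the elements\<close>

declare central_series.simps [simp del]

lemma loop_center_iso:
  assumes P: "is_loop P" and P': "is_loop P'" and \<phi>: "\<phi> \<in> iso P P'" and c: "c \<in> carrier P"
  shows "\<phi> c \<in> loop_center P' \<longleftrightarrow> c \<in> loop_center P"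
proof -
  have im: "carrier P' = \<phi> ` carrier P" and inj: "inj_on \<phi> (carrier P)"
    using \<phi> by (auto simp: iso_def bij_betw_def)
  have mult: "\<phi> x \<otimes>\<^bsub>P'\<^esub> \<phi> y = \<phi> (x \<otimes>\<^bsub>P\<^esub> y)" if "x \<in> carrier P" "y \<in> carrier P" for x y
    using \<phi> that by (auto simp: iso_def hom_def)
  have eq: "\<phi> x = \<phi> y \<longleftrightarrow> x = y" if "x \<in> carrier P" "y \<in> carrier P" for x y
    using inj that by (auto simp: inj_on_def)
  show ?thesis
    unfolding loop_center_iff[OF P] loop_center_iff[OF P'] im
    using c by (simp add: mult eq is_loopD(1)[OF P])
qed

lemma trivial_central_series_Suc:
  assumes Q: "is_loop Q"
  shows "trivial_loop (central_series Q (Suc i)) \<longleftrightarrow>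
    loop_center (central_series Q i) = carrier (central_series Q i)"
proof -
  let ?R = "central_series Q i"
  let ?C = "loop_center ?R"
  have R: "is_loop ?R" by (rule central_series_blocks(1)[OF Q])
  have one: "\<one>\<^bsub>?R Mod ?C\<^esub> = ?C" by (simp add: FactGroup_def)
  have C1: "?C #>\<^bsub>?R\<^esub> \<one>\<^bsub>?R\<^esub> = ?C"
    using is_loopD(4)[OF R] loop_centerD(1)[OF R] by (force simp: r_coset_def)
  have car: "carrier (?R Mod ?C) = (\<lambda>a. ?C #>\<^bsub>?R\<^esub> a) ` carrier ?R"
    unfolding FactGroup_def RCOSETS_def by auto
  have inj: "inj_on \<Union> (carrier (?R Mod ?C))"
    using central_series_iso(2)[OF Q, of i] by (auto simp: iso_def bij_betw_def)
  have C_in: "?C \<in> carrier (?R Mod ?C)"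
    using C1 is_loopD(2)[OF R] unfolding car by force
  have "trivial_loop (central_series Q (Suc i)) \<longleftrightarrow> \<Union> ` carrier (?R Mod ?C) = {\<Union> ?C}"
    by (simp add: trivial_loop_def relabel_def one central_series.simps)
  also have "\<dots> \<longleftrightarrow> carrier (?R Mod ?C) = {?C}"
    using inj C_in inj_on_image_eq_iff[OF inj, of "carrier (?R Mod ?C)" "{?C}"] by simp
  also have "\<dots> \<longleftrightarrow> (\<forall>a \<in> carrier ?R. ?C #>\<^bsub>?R\<^esub> a = ?C)"
    using C_in unfolding car by blast
  also have "\<dots> \<longleftrightarrow> (\<forall>a \<in> carrier ?R. a \<in> ?C)"
  proof (intro ball_cong refl iffI)
    fix a assume a: "a \<in> carrier ?R"
    { assume "?C #>\<^bsub>?R\<^esub> a = ?C"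
      then show "a \<in> ?C" using center_coset_self[OF R a] by simp }
    { assume "a \<in> ?C"
      then show "?C #>\<^bsub>?R\<^esub> a = ?C"
        using center_coset_shift[OF R is_loopD(2)[OF R], of a] C1 is_loopD(4)[OF R a] by simp }
  qed
  also have "\<dots> \<longleftrightarrow> ?C = carrier ?R"
    using loop_centerD(1)[OF R] by blast
  finally show ?thesis .
qed

text \<open>The first term of the series is the quotient by the center, seen through its projection
  from the loop itself; this hides the passage to singletons and unions of blocks.\<close>

lemma central_series_projection:
  assumes Q: "is_loop Q"
  obtains h where "carrier (central_series Q 1) = h ` carrier Q"
    and "\<And>a b. \<lbrakk>a \<in> carrier Q; b \<in> carrier Q\<rbrakk> \<Longrightarrow>
      h a \<otimes>\<^bsub>central_series Q 1\<^esub> h b = h (a \<otimes>\<^bsub>Q\<^esub> b)"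
    and "\<And>a b. \<lbrakk>a \<in> carrier Q; b \<in> carrier Q\<rbrakk> \<Longrightarrow>
      h a = h b \<longleftrightarrow> (\<exists>z \<in> loop_center Q. b = z \<otimes>\<^bsub>Q\<^esub> a)"
proof
  let ?R = "central_series Q 0"
  let ?C = "loop_center ?R"
  let ?h = "\<lambda>x. \<Union> (?C #>\<^bsub>?R\<^esub> {x})"
  have R: "is_loop ?R" by (rule central_series_blocks(1)[OF Q])
  have s: "(\<lambda>x. {x}) \<in> iso Q ?R" by (rule central_series_iso(1)[OF Q])
  have R_car: "carrier ?R = (\<lambda>x. {x}) ` carrier Q" by (simp add: relabel_def central_series.simps)
  have R_mult: "{x} \<otimes>\<^bsub>?R\<^esub> {y} = {x \<otimes>\<^bsub>Q\<^esub> y}" if "x \<in> carrier Q" "y \<in> carrier Q" for x y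
    using s that by (auto simp: iso_def hom_def)
  have u: "\<Union> \<in> iso (?R Mod ?C) (central_series Q 1)"
    using central_series_iso(2)[OF Q, of 0] by simp
  have car: "carrier (?R Mod ?C) = (\<lambda>x. ?C #>\<^bsub>?R\<^esub> {x}) ` carrier Q"
    unfolding FactGroup_def RCOSETS_def by (auto simp: R_car)
  show "carrier (central_series Q 1) = ?h ` carrier Q"
    using u unfolding iso_def bij_betw_def car by (auto simp: image_image)
  fix a b assume ab: "a \<in> carrier Q" "b \<in> carrier Q"
  have abR: "{a} \<in> carrier ?R" "{b} \<in> carrier ?R" using ab R_car by auto
  have "?h a \<otimes>\<^bsub>central_series Q 1\<^esub> ?h b =
      \<Union> ((?C #>\<^bsub>?R\<^esub> {a}) \<otimes>\<^bsub>?R Mod ?C\<^esub> (?C #>\<^bsub>?R\<^esub> {b}))"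
    using u ab unfolding iso_def hom_def car by auto
  also have "\<dots> = ?h (a \<otimes>\<^bsub>Q\<^esub> b)"
    using center_coset_mult[OF R abR] R_mult[OF ab] by (simp add: FactGroup_def)
  finally show "?h a \<otimes>\<^bsub>central_series Q 1\<^esub> ?h b = ?h (a \<otimes>\<^bsub>Q\<^esub> b)" .
  have "inj_on \<Union> (carrier (?R Mod ?C))" using u by (auto simp: iso_def bij_betw_def)
  then have "?h a = ?h b \<longleftrightarrow> ?C #>\<^bsub>?R\<^esub> {a} = ?C #>\<^bsub>?R\<^esub> {b}"
    using ab unfolding car inj_on_def by auto
  also have "\<dots> \<longleftrightarrow> (\<exists>w \<in> ?C. {b} = w \<otimes>\<^bsub>?R\<^esub> {a})"
    by (rule center_coset_eq_iff[OF R abR])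
  also have "\<dots> \<longleftrightarrow> (\<exists>z \<in> loop_center Q. b = z \<otimes>\<^bsub>Q\<^esub> a)"
  proof
    assume "\<exists>w \<in> ?C. {b} = w \<otimes>\<^bsub>?R\<^esub> {a}"
    then obtain w where w: "w \<in> ?C" "{b} = w \<otimes>\<^bsub>?R\<^esub> {a}" by blast
    then obtain z where z: "z \<in> carrier Q" "w = {z}"
      using loop_centerD(1)[OF R w(1)] R_car by auto
    then have "z \<in> loop_center Q" using loop_center_iso[OF Q R s z(1)] w by simp
    moreover have "b = z \<otimes>\<^bsub>Q\<^esub> a" using w(2) z R_mult[OF z(1) ab(1)] by simp
    ultimately show "\<exists>z \<in> loop_center Q. b = z \<otimes>\<^bsub>Q\<^esub> a" by blast
  next
    assume "\<exists>z \<in> loop_center Q. b = z \<otimes>\<^bsub>Q\<^esub> a"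
    then obtain z where z: "z \<in> loop_center Q" "b = z \<otimes>\<^bsub>Q\<^esub> a" by blast
    have zQ: "z \<in> carrier Q" by (rule loop_centerD(1)[OF Q z(1)])
    have "{z} \<in> ?C" using loop_center_iso[OF Q R s zQ] z(1) by simp
    moreover have "{b} = {z} \<otimes>\<^bsub>?R\<^esub> {a}" using R_mult[OF zQ ab(1)] z(2) by simp
    ultimately show "\<exists>w \<in> ?C. {b} = w \<otimes>\<^bsub>?R\<^esub> {a}" by blast
  qed
  finally show "?h a = ?h b \<longleftrightarrow> (\<exists>z \<in> loop_center Q. b = z \<otimes>\<^bsub>Q\<^esub> a)" .
qed

text \<open>The second quotient is trivial exactly when the first one equals its own center, that is,
  when it is commutative and associative; both conditions are pulled back along the projection.\<close>

lemma trivial_central_series_2_iff: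
  assumes Q: "is_loop Q"
  shows "trivial_loop (central_series Q 2) \<longleftrightarrow>
    (\<forall>x \<in> carrier Q. \<forall>y \<in> carrier Q. \<exists>c \<in> loop_center Q. y \<otimes>\<^bsub>Q\<^esub> x = c \<otimes>\<^bsub>Q\<^esub> (x \<otimes>\<^bsub>Q\<^esub> y)) \<and>
    (\<forall>x \<in> carrier Q. \<forall>y \<in> carrier Q. \<forall>z \<in> carrier Q. \<exists>c \<in> loop_center Q.
      x \<otimes>\<^bsub>Q\<^esub> (y \<otimes>\<^bsub>Q\<^esub> z) = c \<otimes>\<^bsub>Q\<^esub> ((x \<otimes>\<^bsub>Q\<^esub> y) \<otimes>\<^bsub>Q\<^esub> z))"
proof -
  let ?R = "central_series Q 1"
  have R: "is_loop ?R" by (rule central_series_blocks(1)[OF Q])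
  obtain h where im: "carrier ?R = h ` carrier Q"
    and mult: "\<And>a b. \<lbrakk>a \<in> carrier Q; b \<in> carrier Q\<rbrakk> \<Longrightarrow> h a \<otimes>\<^bsub>?R\<^esub> h b = h (a \<otimes>\<^bsub>Q\<^esub> b)"
    and eq: "\<And>a b. \<lbrakk>a \<in> carrier Q; b \<in> carrier Q\<rbrakk> \<Longrightarrow>
      h a = h b \<longleftrightarrow> (\<exists>z \<in> loop_center Q. b = z \<otimes>\<^bsub>Q\<^esub> a)"
    using central_series_projection[OF Q] by blast
  note L = is_loopD(1)[OF Q]
  have "trivial_loop (central_series Q 2) \<longleftrightarrow> loop_center ?R = carrier ?R"
    using trivial_central_series_Suc[OF Q, of 1] by (simp add: numeral_2_eq_2)
  also have "\<dots> \<longleftrightarrow> (\<forall>a \<in> carrier ?R. a \<in> loop_center ?R)"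
    using loop_centerD(1)[OF R] by blast
  also have "\<dots> \<longleftrightarrow>
    (\<forall>a \<in> carrier ?R. \<forall>b \<in> carrier ?R. a \<otimes>\<^bsub>?R\<^esub> b = b \<otimes>\<^bsub>?R\<^esub> a) \<and>
    (\<forall>a \<in> carrier ?R. \<forall>b \<in> carrier ?R. \<forall>c \<in> carrier ?R.
      (a \<otimes>\<^bsub>?R\<^esub> b) \<otimes>\<^bsub>?R\<^esub> c = a \<otimes>\<^bsub>?R\<^esub> (b \<otimes>\<^bsub>?R\<^esub> c))"
    unfolding loop_center_iff[OF R] by blast
  also have "\<dots> \<longleftrightarrow>
    (\<forall>x \<in> carrier Q. \<forall>y \<in> carrier Q. h (x \<otimes>\<^bsub>Q\<^esub> y) = h (y \<otimes>\<^bsub>Q\<^esub> x)) \<and>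
    (\<forall>x \<in> carrier Q. \<forall>y \<in> carrier Q. \<forall>z \<in> carrier Q.
      h ((x \<otimes>\<^bsub>Q\<^esub> y) \<otimes>\<^bsub>Q\<^esub> z) = h (x \<otimes>\<^bsub>Q\<^esub> (y \<otimes>\<^bsub>Q\<^esub> z)))"
    unfolding im by (simp add: mult L del: One_nat_def)
  finally show ?thesis by (simp add: eq L)
qed

section \<open>Commutators in a group of class two\<close>

context group
begin

lemma commut_closed [simp]:
  "\<lbrakk>x \<in> carrier G; y \<in> carrier G\<rbrakk> \<Longrightarrow> commut G x y \<in> carrier G"
  by (simp add: commut_def conjg_def)

lemma commut_eq:
  assumes "x \<in> carrier G" "y \<in> carrier G"
  shows "commut G x y = inv (y \<otimes> x) \<otimes> (x \<otimes> y)"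
  using assms by (simp add: commut_def conjg_def inv_mult_group m_assoc)

lemma commut_iff:
  assumes "x \<in> carrier G" "y \<in> carrier G" "u \<in> carrier G"
  shows "commut G x y = u \<longleftrightarrow> x \<otimes> y = y \<otimes> x \<otimes> u"
  using assms by (simp only: commut_eq) (simp add: inv_solve_left')

lemma commut_swap:
  assumes "x \<in> carrier G" "y \<in> carrier G"
  shows "commut G y x = inv (commut G x y)"
  using assms by (simp add: commut_eq inv_mult_group m_assoc)

lemma conjg_eq_commut:
  assumes "x \<in> carrier G" "y \<in> carrier G"
  shows "conjg G x y = x \<otimes> commut G x y"
  using assms by (simp add: commut_def conjg_def m_assoc[symmetric])

text \<open>This serves twice: with \<open>H = N\<close> for the commutativity of \<open>G/N\<close>, and with \<open>H = K\<close> for the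
  centrality of \<open>N/K\<close> in \<open>G/K\<close>.\<close>

lemma commut_in_normal:
  assumes H: "H \<lhd> G" and xy: "x \<in> carrier G" "y \<in> carrier G"
    and eq: "(H #> x) \<otimes>\<^bsub>G Mod H\<^esub> (H #> y) = (H #> y) \<otimes>\<^bsub>G Mod H\<^esub> (H #> x)"
  shows "commut G x y \<in> H"
proof -
  interpret H: normal H G by fact
  have "H #> (x \<otimes> y) = H #> (y \<otimes> x)"
    using eq xy by (simp add: H.rcos_sum)
  then have "x \<otimes> y \<in> H #> (y \<otimes> x)"
    using rcos_self[OF _ H.subgroup_axioms, of "x \<otimes> y"] xy by auto
  then obtain n where n: "n \<in> H" "x \<otimes> y = n \<otimes> (y \<otimes> x)"
    by (auto simp: r_coset_def)
  then have "commut G x y = inv (y \<otimes> x) \<otimes> n \<otimes> (y \<otimes> x)"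
    using xy H.mem_carrier[OF n(1)] by (simp add: commut_eq m_assoc)
  then show ?thesis using H.inv_op_closed1[OF _ n(1)] xy by simp
qed

lemma commut_in_center_of_class_two:
  assumes cl: "has_nilpotency_class G 2" and xy: "x \<in> carrier G" "y \<in> carrier G"
  shows "commut G x y \<in> group_center G"
proof -
  have Q: "is_loop G" by (rule is_loop_group) (rule group_axioms)
  have "trivial_loop (central_series G 2)" using cl by (simp add: has_nilpotency_class_def)
  then obtain c where "c \<in> loop_center G" "x \<otimes> y = c \<otimes> (y \<otimes> x)"
    unfolding trivial_central_series_2_iff[OF Q] using xy by blast
  then have c: "c \<in> group_center G" "x \<otimes> y = c \<otimes> (y \<otimes> x)"
    using loop_center_group[OF group_axioms] by auto
  then have "c \<in> carrier G" "x \<otimes> y = y \<otimes> x \<otimes> c" using xy by (auto simp: group_center_def)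
  then have "commut G x y = c" using xy by (simp add: commut_iff)
  then show ?thesis using c by simp
qed

end

locale central_commutators = group +
  assumes commut_central: "\<lbrakk>x \<in> carrier G; y \<in> carrier G\<rbrakk> \<Longrightarrow> commut G x y \<in> group_center G"
begin

lemma commut_comm:
  "\<lbrakk>x \<in> carrier G; y \<in> carrier G; z \<in> carrier G\<rbrakk> \<Longrightarrow> commut G x y \<otimes> z = z \<otimes> commut G x y"
  using commut_central[of x y] by (simp add: group_center_def)

lemma commut_mult_left:
  assumes a: "a \<in> carrier G" and b: "b \<in> carrier G" and c: "c \<in> carrier G"
  shows "commut G (a \<otimes> b) c = commut G a c \<otimes> commut G b c"
proof -
  have "a \<otimes> b \<otimes> c = a \<otimes> (c \<otimes> b \<otimes> commut G b c)"
    using a b c commut_iff[of b c "commut G b c"] by (simp add: m_assoc)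
  also have "\<dots> = (a \<otimes> c) \<otimes> (b \<otimes> commut G b c)" using a b c by (simp add: m_assoc)
  also have "a \<otimes> c = c \<otimes> a \<otimes> commut G a c"
    using a c commut_iff[of a c "commut G a c"] by simp
  also have "\<dots> \<otimes> (b \<otimes> commut G b c) = c \<otimes> a \<otimes> (commut G a c \<otimes> b) \<otimes> commut G b c"
    using a b c by (simp add: m_assoc)
  also have "\<dots> = c \<otimes> (a \<otimes> b) \<otimes> (commut G a c \<otimes> commut G b c)"
    using a b c by (simp add: commut_comm[OF a c b] m_assoc)
  finally show ?thesis using a b c by (simp add: commut_iff)
qed

text \<open>Additivity in the second argument follows from additivity in the first because \<open>[b,a]\<close> and
  \<open>[a,b]\<close> are inverse to each other and inverting reverses a product of commuting elements.\<close>

lemma commut_mult_right: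
  assumes a: "a \<in> carrier G" and b: "b \<in> carrier G" and c: "c \<in> carrier G"
  shows "commut G a (b \<otimes> c) = commut G a b \<otimes> commut G a c"
proof -
  have "commut G a (b \<otimes> c) = inv (commut G b a \<otimes> commut G c a)"
    using a b c commut_swap[of "b \<otimes> c" a] by (simp add: commut_mult_left)
  also have "\<dots> = commut G a c \<otimes> commut G a b"
    using a b c commut_swap[of b a] commut_swap[of c a] by (simp add: inv_mult_group)
  finally show ?thesis using commut_comm[OF a c, of "commut G a b"] a b c by simp
qed

lemma conjg_mult_swap:
  assumes "x \<in> carrier G" "y \<in> carrier G" "z \<in> carrier G"
  shows "conjg G z (y \<otimes> x) = conjg G z (x \<otimes> y)"
  using assms commut_comm[of z x "commut G z y"]
  by (simp add: conjg_eq_commut commut_mult_right)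

end

section \<open>The associated trilinear form\<close>

text \<open>The locale records the commutator conditions that the hypotheses on the factor groups
  amount to: \<open>commut_in_N\<close> says that \<open>G/N\<close> is abelian, \<open>commut_in_K\<close> that \<open>N/K\<close> is central
  in \<open>G/K\<close>.\<close>

locale mu_data = central_commutators G
  for G :: "('a, 'b) monoid_scheme" (structure) +
  fixes Z K N :: "'a set" and \<mu> :: "'a set \<Rightarrow> 'a set \<Rightarrow> 'a"
  assumes Z: "subgroup Z G" and N: "N \<lhd> G" and K: "K \<lhd> G"
    and ZK: "Z \<subseteq> K" and KN: "K \<subseteq> N"
    and Z_central: "Z \<subseteq> group_center G"
    and \<mu>_in: "\<mu> \<in> carrier (G Mod K) \<rightarrow> carrier (G Mod K) \<rightarrow> Z"
    and \<mu>_one: "\<And>x. x \<in> carrier G \<Longrightarrow> \<mu> (K #> x) K = \<one> \<and> \<mu> K (K #> x) = \<one>"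
    and \<mu>_mult: "\<And>x y z. \<lbrakk>x \<in> carrier G; y \<in> carrier G; z \<in> carrier G; {x, y, z} \<inter> N \<noteq> {}\<rbrakk> \<Longrightarrow>
           mu_lift G K \<mu> (x \<otimes> y) z = mu_lift G K \<mu> x z \<otimes> mu_lift G K \<mu> y z \<and>
           mu_lift G K \<mu> x (y \<otimes> z) = mu_lift G K \<mu> x y \<otimes> mu_lift G K \<mu> x z"
    and \<delta>_identity: "\<And>x y z. \<lbrakk>x \<in> carrier G; y \<in> carrier G; z \<in> carrier G\<rbrakk> \<Longrightarrow>
           conjg G z (y \<otimes> x) \<otimes> mu_delta G K \<mu> (commut G z y) x =
           conjg G z (x \<otimes> y) \<otimes> mu_delta G K \<mu> (commut G z x) y"
    and commut_in_N: "\<lbrakk>x \<in> carrier G; y \<in> carrier G\<rbrakk> \<Longrightarrow> commut G x y \<in> N"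
    and commut_in_K: "\<lbrakk>x \<in> carrier G; n \<in> N\<rbrakk> \<Longrightarrow> commut G n x \<in> K"
begin

sublocale K: normal K G by (rule K)
sublocale N: normal N G by (rule N)
sublocale Z: subgroup Z G by (rule Z)

abbreviation lift :: "'a \<Rightarrow> 'a \<Rightarrow> 'a" where "lift \<equiv> mu_lift G K \<mu>"
abbreviation \<delta> :: "'a \<Rightarrow> 'a \<Rightarrow> 'a" where "\<delta> \<equiv> mu_delta G K \<mu>"
abbreviation form :: "'a \<Rightarrow> 'a \<Rightarrow> 'a \<Rightarrow> 'a" where "form x y z \<equiv> \<delta> (commut G x y) z"

lemma Z_comm: "\<lbrakk>z \<in> Z; x \<in> carrier G\<rbrakk> \<Longrightarrow> x \<otimes> z = z \<otimes> x"
  using Z_central by (auto simp: group_center_def)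

lemma Z_left_comm:
  assumes "z \<in> Z" "x \<in> carrier G" "y \<in> carrier G"
  shows "x \<otimes> (z \<otimes> y) = z \<otimes> (x \<otimes> y)"
  using assms Z_comm[of z x] Z.mem_carrier[of z] by (simp add: m_assoc[symmetric])

lemma lift_in_Z [simp]:
  "\<lbrakk>x \<in> carrier G; y \<in> carrier G\<rbrakk> \<Longrightarrow> lift x y \<in> Z"
  using \<mu>_in unfolding mu_lift_def FactGroup_def RCOSETS_def by (auto simp: Pi_iff)

lemma lift_closed [simp]:
  "\<lbrakk>x \<in> carrier G; y \<in> carrier G\<rbrakk> \<Longrightarrow> lift x y \<in> carrier G"
  using Z.mem_carrier by simp

lemma lift_K:
  assumes "k \<in> K" "x \<in> carrier G"
  shows "lift k x = \<one>" "lift x k = \<one>"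
proof -
  have "K #> k = K" using assms K.subgroup_axioms by (simp add: coset_join2)
  then show "lift k x = \<one>" "lift x k = \<one>" using \<mu>_one assms by (auto simp: mu_lift_def)
qed

lemma lift_mult_left:
  "\<lbrakk>x \<in> carrier G; y \<in> carrier G; z \<in> carrier G; x \<in> N \<or> y \<in> N \<or> z \<in> N\<rbrakk> \<Longrightarrow>
    lift (x \<otimes> y) z = lift x z \<otimes> lift y z"
  using \<mu>_mult[of x y z] by auto

lemma lift_mult_right:
  "\<lbrakk>x \<in> carrier G; y \<in> carrier G; z \<in> carrier G; x \<in> N \<or> y \<in> N \<or> z \<in> N\<rbrakk> \<Longrightarrow>
    lift x (y \<otimes> z) = lift x y \<otimes> lift x z"
  using \<mu>_mult[of x y z] by auto

lemma \<delta>_in_Z [simp]: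
  "\<lbrakk>x \<in> carrier G; y \<in> carrier G\<rbrakk> \<Longrightarrow> \<delta> x y \<in> Z"
  by (simp add: mu_delta_def)

lemma \<delta>_closed [simp]:
  "\<lbrakk>x \<in> carrier G; y \<in> carrier G\<rbrakk> \<Longrightarrow> \<delta> x y \<in> carrier G"
  using Z.mem_carrier by simp

lemma \<delta>_K:
  "\<lbrakk>k \<in> K; x \<in> carrier G\<rbrakk> \<Longrightarrow> \<delta> k x = \<one>"
  by (simp add: mu_delta_def lift_K)

lemma \<delta>_one_iff:
  "\<lbrakk>x \<in> carrier G; y \<in> carrier G\<rbrakk> \<Longrightarrow> \<delta> x y = \<one> \<longleftrightarrow> lift x y = lift y x"
  by (simp add: mu_delta_def inv_solve_right')

lemma \<delta>_mult_left:
  assumes "x \<in> carrier G" "y \<in> carrier G" "z \<in> carrier G" "x \<in> N \<or> y \<in> N \<or> z \<in> N"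
  shows "\<delta> (x \<otimes> y) z = \<delta> x z \<otimes> \<delta> y z"
  using assms
  by (auto simp: mu_delta_def lift_mult_left lift_mult_right inv_mult_group m_assoc Z_comm Z_left_comm)

lemma \<delta>_mult_right:
  assumes "x \<in> carrier G" "y \<in> carrier G" "z \<in> carrier G" "x \<in> N \<or> y \<in> N \<or> z \<in> N"
  shows "\<delta> x (y \<otimes> z) = \<delta> x y \<otimes> \<delta> x z"
  using assms
  by (auto simp: mu_delta_def lift_mult_left lift_mult_right inv_mult_group m_assoc Z_comm Z_left_comm)

lemma form_swap23:
  assumes "x \<in> carrier G" "y \<in> carrier G" "z \<in> carrier G"
  shows "form x y z = form x z y"
proof -
  have "conjg G x (y \<otimes> z) \<otimes> form x y z = conjg G x (y \<otimes> z) \<otimes> form x z y"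
    using \<delta>_identity[of z y x] conjg_mult_swap[of z y x] assms by simp
  then show ?thesis using assms by (simp add: conjg_def)
qed

lemma form_mult:
  assumes "a \<in> carrier G" "b \<in> carrier G" "y \<in> carrier G" "z \<in> carrier G"
  shows "form (a \<otimes> b) y z = form a y z \<otimes> form b y z"
  using assms by (simp add: commut_mult_left \<delta>_mult_left commut_in_N)

lemma form_antisym:
  assumes "x \<in> carrier G" "y \<in> carrier G" "z \<in> carrier G"
  shows "form x y z \<otimes> form y x z = \<one>"
proof -
  have "form x y z \<otimes> form y x z = \<delta> (commut G x y \<otimes> commut G y x) z"
    using assms by (simp add: \<delta>_mult_left commut_in_N)
  also have "\<dots> = \<one>"
    using assms commut_swap[of x y] by (simp add: \<delta>_K)
  finally show ?thesis .
qed

text \<open>Going from \<open>(z,y,x)\<close> to \<open>(x,y,z)\<close> by exchanging the first two arguments, then the last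
  two, then the first two again introduces two signs, which cancel.\<close>

lemma form_swap13:
  assumes "x \<in> carrier G" "y \<in> carrier G" "z \<in> carrier G"
  shows "form z y x = form x y z"
proof -
  have swap_inv: "form b a c = inv (form a b c)" if "a \<in> carrier G" "b \<in> carrier G" "c \<in> carrier G" for a b c
    using that form_antisym[of b a c] by (simp add: inv_equality)
  have "form z y x = inv (form y z x)" using assms by (intro swap_inv)
  also have "form y z x = form y x z" using assms by (intro form_swap23)
  also have "inv (form y x z) = form x y z" using swap_inv[of x y z] assms by simp
  finally show ?thesis .
qed

text \<open>The same exchange written as \<open>(1 3)(2 3)(1 3)\<close> uses no sign at all, in contrast to
  \<open>form_antisym\<close>; comparing the two gives \<open>form_square\<close>.\<close>

lemma form_swap12:
  assumes "x \<in> carrier G" "y \<in> carrier G" "z \<in> carrier G"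
  shows "form y x z = form x y z"
  using assms form_swap13[of z x y] form_swap23[of z x y] form_swap13[of x y z] by simp

lemma form_square:
  assumes "x \<in> carrier G" "y \<in> carrier G" "z \<in> carrier G"
  shows "form x y z \<otimes> form x y z = \<one>"
  using assms form_antisym[of x y z] form_swap12[of x y z] by simp

lemma form_N:
  "\<lbrakk>n \<in> N; y \<in> carrier G; z \<in> carrier G\<rbrakk> \<Longrightarrow> form n y z = \<one>"
  by (simp add: commut_in_K \<delta>_K)

lemma form_coset1:
  assumes "x \<in> carrier G" "y \<in> carrier G" "z \<in> carrier G" "x' \<in> N #> x"
  shows "form x' y z = form x y z"
  using assms by (auto simp: r_coset_def form_mult form_N)

lemma form_coset:
  assumes "x \<in> carrier G" "y \<in> carrier G" "z \<in> carrier G"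
    and "x' \<in> N #> x" "y' \<in> N #> y" "z' \<in> N #> z"
  shows "form x' y' z' = form x y z"
proof -
  have c: "x' \<in> carrier G" "y' \<in> carrier G" "z' \<in> carrier G"
    using assms by (auto simp: r_coset_def)
  have "form x' y' z' = form x y' z'" using assms c by (simp add: form_coset1)
  also have "\<dots> = form y' x z'" using assms c by (simp add: form_swap12)
  also have "\<dots> = form y x z'" using assms c by (simp add: form_coset1)
  also have "\<dots> = form z' x y" using assms c by (simp add: form_swap13)
  also have "\<dots> = form z x y" using assms c by (simp add: form_coset1)
  also have "\<dots> = form y x z" using assms by (simp add: form_swap13)
  also have "\<dots> = form x y z" using assms by (simp add: form_swap12)
  finally show ?thesis .
qed

section \<open>The loop when the form vanishes\<close>

lemma mu_loop_is_loop: "is_loop (mu_loop G K \<mu>)"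
  using is_loop_mu_loop[OF group_axioms Z K ZK Z_central \<mu>_in \<mu>_one] .

lemma lift_mult_Z:
  assumes "x \<in> carrier G" "y \<in> carrier G" "z \<in> Z"
  shows "lift (x \<otimes> z) y = lift x y" "lift y (x \<otimes> z) = lift y x"
  using assms ZK KN by (auto simp: lift_mult_left lift_mult_right lift_K subset_iff)

text \<open>The correction factors already present in a product lie in \<open>Z\<close>, so they do not affect the
  further values of \<open>\<mu>\<close>. Both bracketings become the same group product times an element of \<open>Z\<close>, and
  the loop is associative on \<open>x\<close>, \<open>y\<close>, \<open>z\<close> if and only if the two elements of \<open>Z\<close> agree.\<close>

lemma mu_loop_mult_assoc:
  assumes "x \<in> carrier G" "y \<in> carrier G" "z \<in> carrier G"
  shows "(x \<otimes>\<^bsub>mu_loop G K \<mu>\<^esub> y) \<otimes>\<^bsub>mu_loop G K \<mu>\<^esub> z = x \<otimes> y \<otimes> z \<otimes> (lift x y \<otimes> lift (x \<otimes> y) z)"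
    and "x \<otimes>\<^bsub>mu_loop G K \<mu>\<^esub> (y \<otimes>\<^bsub>mu_loop G K \<mu>\<^esub> z) = x \<otimes> y \<otimes> z \<otimes> (lift y z \<otimes> lift x (y \<otimes> z))"
proof -
  have "x \<otimes> y \<otimes> lift x y \<otimes> z = x \<otimes> y \<otimes> z \<otimes> lift x y"
    using assms Z_comm[of "lift x y" z] by (simp add: m_assoc)
  then show "(x \<otimes>\<^bsub>mu_loop G K \<mu>\<^esub> y) \<otimes>\<^bsub>mu_loop G K \<mu>\<^esub> z = x \<otimes> y \<otimes> z \<otimes> (lift x y \<otimes> lift (x \<otimes> y) z)"
    using assms by (simp add: mu_loop_def lift_mult_Z) (simp add: m_assoc)
  show "x \<otimes>\<^bsub>mu_loop G K \<mu>\<^esub> (y \<otimes>\<^bsub>mu_loop G K \<mu>\<^esub> z) = x \<otimes> y \<otimes> z \<otimes> (lift y z \<otimes> lift x (y \<otimes> z))"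
    using assms by (simp add: mu_loop_def lift_mult_Z) (simp add: m_assoc)
qed

lemma mu_loop_center:
  assumes c: "c \<in> N" "c \<in> group_center G" and \<delta>: "\<And>y. y \<in> carrier G \<Longrightarrow> \<delta> c y = \<one>"
  shows "c \<in> loop_center (mu_loop G K \<mu>)"
proof -
  let ?Q = "mu_loop G K \<mu>"
  have cG: "c \<in> carrier G" using c by simp
  \<comment> \<open>With one argument in \<open>N\<close>, both elements of \<open>Z\<close> split into the values of \<open>\<mu>\<close> at the
    three pairs \<open>(x,y)\<close>, \<open>(x,z)\<close> and \<open>(y,z)\<close>.\<close>
  have nuc: "(x \<otimes>\<^bsub>?Q\<^esub> y) \<otimes>\<^bsub>?Q\<^esub> z = x \<otimes>\<^bsub>?Q\<^esub> (y \<otimes>\<^bsub>?Q\<^esub> z)"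
    if "x \<in> carrier G" "y \<in> carrier G" "z \<in> carrier G" "x \<in> N \<or> y \<in> N \<or> z \<in> N" for x y z
    using that
    by (simp add: mu_loop_mult_assoc lift_mult_left lift_mult_right Z_comm Z_left_comm)
  have com: "c \<otimes>\<^bsub>?Q\<^esub> y = y \<otimes>\<^bsub>?Q\<^esub> c" if "y \<in> carrier G" for y
    using that \<delta>_one_iff[of c y] \<delta>[of y] c cG by (simp add: mu_loop_def group_center_def)
  have car: "carrier ?Q = carrier G" by (simp add: mu_loop_def)
  show ?thesis
    unfolding loop_center_iff[OF mu_loop_is_loop] car using c cG nuc com by blast
qed

text \<open>The two sides of the commutative law differ, up to an element of \<open>Z\<close>, by a commutator of
  \<open>G\<close>, and the two sides of the associative law differ by an element of \<open>Z\<close>; both kinds of elements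
  are central in the loop.\<close>

lemma mu_loop_class_le_two:
  assumes triv: "\<And>x y z. \<lbrakk>x \<in> carrier G; y \<in> carrier G; z \<in> carrier G\<rbrakk> \<Longrightarrow> form x y z = \<one>"
  shows "trivial_loop (central_series (mu_loop G K \<mu>) 2)"
proof -
  let ?Q = "mu_loop G K \<mu>"
  have car: "carrier ?Q = carrier G" by (simp add: mu_loop_def)
  have Z_in: "z \<in> loop_center ?Q" if "z \<in> Z" for z
    using that ZK KN Z_central \<delta>_K by (intro mu_loop_center) auto
  have Z_mult: "w \<otimes>\<^bsub>?Q\<^esub> g = g \<otimes> w" if "w \<in> Z" "g \<in> carrier G" for w g
    using that ZK lift_K(1)[of w g] Z_comm[of w g] by (auto simp: mu_loop_def)
  have cancel: "w \<otimes> (inv w \<otimes> t) = t" if "w \<in> carrier G" "t \<in> carrier G" for w t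
    using that by (simp add: m_assoc[symmetric])
  \<comment> \<open>The factors \<open>u\<close> and \<open>z\<close> refer to the product of \<open>G\<close>; in the loop, the value \<open>\<mu>(u, a)\<close>
    that arises from multiplying by \<open>u\<close> has to be compensated within \<open>Z\<close>.\<close>
  have mult_center: "\<exists>c \<in> loop_center ?Q. u \<otimes> a \<otimes> z = c \<otimes>\<^bsub>?Q\<^esub> a"
    if a: "a \<in> carrier G" and u: "u \<in> loop_center ?Q" "u \<in> carrier G" and z: "z \<in> Z" for a u z
  proof -
    let ?w = "inv (lift u a) \<otimes> z"
    have w: "?w \<in> Z" using a u z by simp
    have "u \<otimes> a \<otimes> z = (u \<otimes> a \<otimes> lift u a) \<otimes> ?w"
      using a u Z.mem_carrier[OF z] by (simp add: m_assoc cancel)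
    also have "\<dots> = (u \<otimes>\<^bsub>?Q\<^esub> a) \<otimes> ?w" by (simp add: mu_loop_def)
    also have "\<dots> = ?w \<otimes>\<^bsub>?Q\<^esub> (u \<otimes>\<^bsub>?Q\<^esub> a)"
      using Z_mult[OF w, of "u \<otimes>\<^bsub>?Q\<^esub> a", symmetric] a u by (simp add: mu_loop_def)
    also have "\<dots> = (?w \<otimes>\<^bsub>?Q\<^esub> u) \<otimes>\<^bsub>?Q\<^esub> a"
      using loop_centerD(2)[OF mu_loop_is_loop Z_in[OF w], of u a] a u by (simp add: car)
    finally show ?thesis
      using loop_center_closed[OF mu_loop_is_loop Z_in[OF w] u(1)] by blast
  qed
  show ?thesis
    unfolding trivial_central_series_2_iff[OF mu_loop_is_loop] car
  proof (intro conjI ballI)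
    fix x y assume xy: "x \<in> carrier G" "y \<in> carrier G"
    let ?u = "commut G y x"
    have u: "?u \<in> loop_center ?Q"
      using xy commut_in_N commut_central triv by (intro mu_loop_center) auto
    have "y \<otimes> x = ?u \<otimes> (x \<otimes> y)"
      using xy commut_iff[of y x ?u] commut_comm[of y x "x \<otimes> y"] by simp
    then have "y \<otimes>\<^bsub>?Q\<^esub> x = ?u \<otimes> (x \<otimes>\<^bsub>?Q\<^esub> y) \<otimes> (inv (lift x y) \<otimes> lift y x)"
      using xy by (simp add: mu_loop_def m_assoc cancel)
    moreover have "x \<otimes>\<^bsub>?Q\<^esub> y \<in> carrier G" using xy by (simp add: mu_loop_def)
    ultimately show "\<exists>c \<in> loop_center ?Q. y \<otimes>\<^bsub>?Q\<^esub> x = c \<otimes>\<^bsub>?Q\<^esub> (x \<otimes>\<^bsub>?Q\<^esub> y)"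
      using mult_center[OF _ u, of "x \<otimes>\<^bsub>?Q\<^esub> y" "inv (lift x y) \<otimes> lift y x"] xy by simp
  next
    fix x y z assume xyz: "x \<in> carrier G" "y \<in> carrier G" "z \<in> carrier G"
    let ?a = "(x \<otimes>\<^bsub>?Q\<^esub> y) \<otimes>\<^bsub>?Q\<^esub> z"
    let ?s = "lift x y \<otimes> lift (x \<otimes> y) z" and ?t = "lift y z \<otimes> lift x (y \<otimes> z)"
    have "x \<otimes>\<^bsub>?Q\<^esub> (y \<otimes>\<^bsub>?Q\<^esub> z) = \<one> \<otimes> ?a \<otimes> (inv ?s \<otimes> ?t)"
      using xyz cancel[of ?s ?t] m_assoc[of "x \<otimes> y \<otimes> z" ?s "inv ?s \<otimes> ?t"]
      by (simp add: mu_loop_mult_assoc)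
    moreover have "?a \<in> carrier G" using xyz by (simp add: mu_loop_mult_assoc)
    ultimately show "\<exists>c \<in> loop_center ?Q. x \<otimes>\<^bsub>?Q\<^esub> (y \<otimes>\<^bsub>?Q\<^esub> z) = c \<otimes>\<^bsub>?Q\<^esub> ?a"
      using mult_center[of ?a \<one> "inv ?s \<otimes> ?t"] Z_in xyz by simp
  qed
qed

end

section \<open>The form as a map on the factor group\<close>

lemma subgroup_square_one:
  assumes "group G" and Z: "subgroup Z G" and c: "Z \<subseteq> group_center G"
  shows "subgroup {a \<in> Z. a \<otimes>\<^bsub>G\<^esub> a = \<one>\<^bsub>G\<^esub>} G"
proof -
  interpret group G by fact
  interpret Z: subgroup Z G by fact
  have mult: "a \<otimes>\<^bsub>G\<^esub> b \<otimes>\<^bsub>G\<^esub> (a \<otimes>\<^bsub>G\<^esub> b) = (a \<otimes>\<^bsub>G\<^esub> a) \<otimes>\<^bsub>G\<^esub> (b \<otimes>\<^bsub>G\<^esub> b)"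
    if "a \<in> Z" "b \<in> Z" for a b
  proof -
    have "b \<otimes>\<^bsub>G\<^esub> a = a \<otimes>\<^bsub>G\<^esub> b" using c that by (auto simp: group_center_def)
    then have "b \<otimes>\<^bsub>G\<^esub> (a \<otimes>\<^bsub>G\<^esub> b) = a \<otimes>\<^bsub>G\<^esub> (b \<otimes>\<^bsub>G\<^esub> b)"
      using that by (simp add: m_assoc[symmetric])
    then show ?thesis using that by (simp add: m_assoc)
  qed
  show ?thesis
  proof (rule subgroupI)
    fix a assume "a \<in> {a \<in> Z. a \<otimes>\<^bsub>G\<^esub> a = \<one>\<^bsub>G\<^esub>}"
    then show "inv\<^bsub>G\<^esub> a \<in> {a \<in> Z. a \<otimes>\<^bsub>G\<^esub> a = \<one>\<^bsub>G\<^esub>}"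
      using inv_mult_group[of a a] by auto
  qed (auto simp: mult intro: exI[of _ "\<one>\<^bsub>G\<^esub>"])
qed

lemma permutes_123_invariant:
  assumes \<sigma>: "\<sigma> permutes {1, 2, 3::nat}"
    and swap: "\<And>x y z. \<lbrakk>x \<in> A; y \<in> A; z \<in> A\<rbrakk> \<Longrightarrow> f y x z = f x y z"
      "\<And>x y z. \<lbrakk>x \<in> A; y \<in> A; z \<in> A\<rbrakk> \<Longrightarrow> f x z y = f x y z"
    and a: "a 1 \<in> A" "a 2 \<in> A" "a 3 \<in> A"
  shows "f (a (\<sigma> 1)) (a (\<sigma> 2)) (a (\<sigma> 3)) = f (a 1) (a 2) (a 3)"
proof -
  have "\<sigma> 1 \<in> {1, 2, 3}" "\<sigma> 2 \<in> {1, 2, 3}" "\<sigma> 3 \<in> {1, 2, 3}"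
    using permutes_in_image[OF \<sigma>] by auto
  moreover have "\<sigma> 1 \<noteq> \<sigma> 2" "\<sigma> 1 \<noteq> \<sigma> 3" "\<sigma> 2 \<noteq> \<sigma> 3"
    using permutes_inj[OF \<sigma>] by (simp_all add: inj_eq)
  moreover have "f (a 2) (a 3) (a 1) = f (a 1) (a 2) (a 3)" "f (a 3) (a 1) (a 2) = f (a 1) (a 2) (a 3)"
    "f (a 3) (a 2) (a 1) = f (a 1) (a 2) (a 3)"
    by (metis swap a)+
  ultimately show ?thesis
    using swap(1)[OF a] swap(2)[OF a] by auto
qed

theorem proposition4p13:
  fixes G :: "('a, 'b) monoid_scheme" (structure)
    and Z K N :: "'a set"
    and \<mu> :: "'a set \<Rightarrow> 'a set \<Rightarrow> 'a"
  assumes "group G"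
    and "subgroup Z G" and "N \<lhd> G" and "K \<lhd> G"
    and "Z \<subseteq> K" and "K \<subseteq> N"
    and "comm_group (G\<lparr>carrier := N\<rparr>)"
    and "comm_group (G Mod N)"
    and "Z \<subseteq> group_center G"
    and "carrier (G\<lparr>carrier := N\<rparr> Mod K) \<subseteq> group_center (G Mod K)"
    and "\<mu> \<in> carrier (G Mod K) \<rightarrow> carrier (G Mod K) \<rightarrow> Z"
    and "\<And>x. x \<in> carrier G \<Longrightarrow> \<mu> (K #> x) K = \<one> \<and> \<mu> K (K #> x) = \<one>"
    and "\<And>x y z. \<lbrakk>x \<in> carrier G; y \<in> carrier G; z \<in> carrier G; {x, y, z} \<inter> N \<noteq> {}\<rbrakk> \<Longrightarrow>
           mu_lift G K \<mu> (x \<otimes> y) z = mu_lift G K \<mu> x z \<otimes> mu_lift G K \<mu> y z \<and>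
           mu_lift G K \<mu> x (y \<otimes> z) = mu_lift G K \<mu> x y \<otimes> mu_lift G K \<mu> x z"
    and "\<And>x y z. \<lbrakk>x \<in> carrier G; y \<in> carrier G; z \<in> carrier G\<rbrakk> \<Longrightarrow>
           conjg G z (y \<otimes> x) \<otimes> mu_delta G K \<mu> (commut G z y) x =
           conjg G z (x \<otimes> y) \<otimes> mu_delta G K \<mu> (commut G z x) y"
    and "has_nilpotency_class G 2"
    and "has_nilpotency_class (mu_loop G K \<mu>) 3"
  shows "\<exists>A f. subgroup A G \<and> A \<subseteq> Z \<and> has_exponent (G\<lparr>carrier := A\<rparr>) 2 \<and>
           symmetric_triadditive (G Mod N) (G\<lparr>carrier := A\<rparr>) f \<and>
           nontrivial_map3 (G Mod N) (G\<lparr>carrier := A\<rparr>) f \<and>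
           (\<forall>x \<in> carrier G. \<forall>y \<in> carrier G. \<forall>z \<in> carrier G.
              mu_delta G K \<mu> (commut G x y) z = f (N #> x) (N #> y) (N #> z))"
proof -
  interpret group G by fact
  interpret GN: comm_group "G Mod N" by fact
  interpret Nn: normal N G by fact
  have coset: "H #> x \<in> carrier (G Mod H)" if "x \<in> carrier G" for H x
    using that by (auto simp: FactGroup_def RCOSETS_def)
  have in_N: "commut G x y \<in> N" if "x \<in> carrier G" "y \<in> carrier G" for x y
    using that coset by (intro commut_in_normal[OF assms(3)] GN.m_comm) auto
  have in_K: "commut G n x \<in> K" if "x \<in> carrier G" "n \<in> N" for n x
  proof (rule commut_in_normal[OF assms(4)])
    have "K #> n \<in> carrier (G\<lparr>carrier := N\<rparr> Mod K)"
      using that by (auto simp: FactGroup_def RCOSETS_def r_coset_def)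
    then have "K #> n \<in> group_center (G Mod K)" using assms(10) by blast
    then show "(K #> n) \<otimes>\<^bsub>G Mod K\<^esub> (K #> x) = (K #> x) \<otimes>\<^bsub>G Mod K\<^esub> (K #> n)"
      using coset[OF that(1)] by (simp add: group_center_def)
  qed (use that Nn.mem_carrier in auto)
  have central: "commut G x y \<in> group_center G" if "x \<in> carrier G" "y \<in> carrier G" for x y
    using commut_in_center_of_class_two[OF assms(15) that] .
  interpret mu_data G Z K N \<mu>
    by (intro mu_data.intro mu_data_axioms.intro central_commutators.intro
        central_commutators_axioms.intro) (fact assms central in_N in_K)+
  define A where "A = {a \<in> Z. a \<otimes> a = \<one>}"
  define rep where "rep U = (SOME x. x \<in> U)" for U :: "'a set"
  define f where "f U V W = form (rep U) (rep V) (rep W)" for U V W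
  have rep: "rep (N #> x) \<in> N #> x" if "x \<in> carrier G" for x
    unfolding rep_def using rcos_self[OF that Nn.subgroup_axioms] by (rule someI)
  have f: "f (N #> x) (N #> y) (N #> z) = form x y z"
    if "x \<in> carrier G" "y \<in> carrier G" "z \<in> carrier G" for x y z
    unfolding f_def using that rep by (intro form_coset) auto
  have carN: "carrier (G Mod N) = (\<lambda>x. N #> x) ` carrier G"
    by (auto simp: FactGroup_def RCOSETS_def)
  have form_A: "form x y z \<in> A" if "x \<in> carrier G" "y \<in> carrier G" "z \<in> carrier G" for x y z
    using that form_square unfolding A_def by auto
  have A: "subgroup A G"
    unfolding A_def by (rule subgroup_square_one[OF assms(1,2,9)])
  obtain x0 y0 z0 where ne: "x0 \<in> carrier G" "y0 \<in> carrier G" "z0 \<in> carrier G" "form x0 y0 z0 \<noteq> \<one>"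
    using mu_loop_class_le_two assms(16) unfolding has_nilpotency_class_def by force
  have "has_exponent (G\<lparr>carrier := A\<rparr>) 2"
    unfolding has_exponent_def
  proof (intro conjI allI impI ballI)
    fix a assume "a \<in> carrier (G\<lparr>carrier := A\<rparr>)"
    then have a: "a \<in> carrier G" "a \<otimes> a = \<one>" using Z.mem_carrier by (auto simp: A_def)
    then show "a [^]\<^bsub>G\<lparr>carrier := A\<rparr>\<^esub> (2::nat) = \<one>\<^bsub>G\<lparr>carrier := A\<rparr>\<^esub>"
      by (simp add: nat_pow_consistent[symmetric] numeral_2_eq_2)
  next
    fix k :: nat assume "0 < k \<and> k < 2"
    then have k: "k = 1" by simp
    show "\<exists>a \<in> carrier (G\<lparr>carrier := A\<rparr>). a [^]\<^bsub>G\<lparr>carrier := A\<rparr>\<^esub> k \<noteq> \<one>\<^bsub>G\<lparr>carrier := A\<rparr>\<^esub>"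
      using ne form_A[OF ne(1-3)] unfolding k
      by (intro bexI[of _ "form x0 y0 z0"]) (auto simp: nat_pow_consistent[symmetric])
  qed simp
  moreover have "symmetric_triadditive (G Mod N) (G\<lparr>carrier := A\<rparr>) f"
    unfolding symmetric_triadditive_def
  proof (intro conjI allI impI ballI)
    show "f \<in> carrier (G Mod N) \<rightarrow> carrier (G Mod N) \<rightarrow> carrier (G Mod N) \<rightarrow> carrier (G\<lparr>carrier := A\<rparr>)"
      by (auto simp: carN f form_A)
  next
    fix \<sigma> :: "nat \<Rightarrow> nat" and a :: "nat \<Rightarrow> 'a set"
    assume "\<sigma> permutes {1, 2, 3} \<and> a \<in> {1, 2, 3} \<rightarrow> carrier (G Mod N)"
    then have "\<sigma> permutes {1, 2, 3}" "a 1 \<in> carrier (G Mod N)" "a 2 \<in> carrier (G Mod N)"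
      "a 3 \<in> carrier (G Mod N)" by auto
    then show "f (a 1) (a 2) (a 3) = f (a (\<sigma> 1)) (a (\<sigma> 2)) (a (\<sigma> 3))"
      by (intro permutes_123_invariant[where A = "carrier (G Mod N)" and f = f and a = a, THEN sym])
        (auto simp: carN f form_swap12 form_swap23)
  next
    fix a b c d
    assume "a \<in> carrier (G Mod N)" "b \<in> carrier (G Mod N)" "c \<in> carrier (G Mod N)" "d \<in> carrier (G Mod N)"
    then show "f (a \<otimes>\<^bsub>G Mod N\<^esub> b) c d = f a c d \<otimes>\<^bsub>G\<lparr>carrier := A\<rparr>\<^esub> f b c d"
      by (auto simp: carN Nn.rcos_sum f form_mult)
  qed
  moreover have "nontrivial_map3 (G Mod N) (G\<lparr>carrier := A\<rparr>) f"
    unfolding nontrivial_map3_def carN using ne f[OF ne(1-3)] by simp metis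
  moreover have "A \<subseteq> Z" by (auto simp: A_def)
  ultimately show ?thesis
    using A f by (intro exI[of _ A] exI[of _ f]) simp
qed

end
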